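(* Let $\mu$ be a Radon measure on $\mathbb{R}^n$ and $T$ a $\mu$-measurable map of $\mathbb{R}^n$ to $\bigcup_{m=0}^nG(n,m)$ such that for every unit vector $e\in\mathbb{R}^n$ and $0<\alpha<1$, the set $\{x\in\mathbb{R}^n:C_{e,\alpha}\cap T(x)=\{0\}\}$ is the union of a $\mu$-null set and a set $E$ with $w_{e,\alpha}(E)=0$. Then there is a real-valued Lipschitz function $f$ on $\mathbb{R}^n$ such that for $\mu$-a.e. $x\in\mathbb{R}^n$ there is $c>0$ such that $$D^+f(x;v)-D_+f(x;v)\ge c\,\mathrm{dist}(v,T(x))$$ for every $v\in\mathbb{R}^n$.
   Context: $\mathbb{R}^n$ carries the Euclidean norm $\|\cdot\|$ and inner product $\langle\cdot,\cdot\rangle$; $\mathcal{H}^1$ is one-dimensional Hausdorff measure; $G(n,m)$ is the Grassmannian of $m$-dimensional linear subspaces of $\mathbb{R}^n$. Upper and lower directional derivatives: $D^+f(x;y)=\limsup_{t\searrow0}\frac{f(x+ty)-f(x)}{t}$ and $D_+f(x;y)=\liminf_{t\searrow0}\frac{f(x+ty)-f(x)}{t}$. Width. For $e\in\mathbb{R}^n\setminus\{0\}$ and $\alpha\in(0,1]$ let $C_{e,\alpha}=\{x\in\mathbb{R}^n:\langle x,e\rangle\ge\alpha\|x\|\|e\|\}$ and let $\Gamma_{e,\alpha}$ be the set of Lipschitz curves $\gamma:\mathbb{R}\to\mathbb{R}^n$ such that $\gamma'(t)\in C_{e,\alpha}$ for almost every $t\in\mathbb{R}$. For open $G\subset\mathbb{R}^n$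 let $w_{e,\alpha}(G)=\sup\{\mathcal{H}^1(G\cap\gamma(\mathbb{R})):\gamma\in\Gamma_{e,\alpha}\}$, and for arbitrary $E\subset\mathbb{R}^n$ let $w_{e,\alpha}(E)=\inf\{w_{e,\alpha}(G):G\supset E,\ G\text{ open}\}$. *)

theory Defs
  imports "HOL-Analysis.Analysis"
begin

text \<open>
  Radon measures are Borel measures that are finite on compact sets, inner regular on open sets
  and outer regular on Borel sets. Measurability and null sets with respect to the associated outer
  measure are those of the completion, so they are expressed through \<^const>\<open>completion\<close>.
\<close>

definition radon_measure :: "'a::euclidean_space measure \<Rightarrow> bool" where
  "radon_measure M \<longleftrightarrow>
     sets M = sets borel \<and>
     (\<forall>K. compact K \<longrightarrow> emeasure M K < \<infinity>) \<and>
     (\<forall>U. open U \<longrightarrow> emeasure M U = (SUP K\<in>{K. compact K \<and> K \<subseteq> U}. emeasure M K)) \<and>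
     (\<forall>B\<in>sets borel. emeasure M B = (INF U\<in>{U. open U \<and> B \<subseteq> U}. emeasure M U))"

definition Grassmannian :: "nat \<Rightarrow> 'a::euclidean_space set set" where
  "Grassmannian m = {V. subspace V \<and> dim V = m}"

definition all_subspaces :: "'a::euclidean_space set set" where
  "all_subspaces = (\<Union>m\<in>{0..DIM('a)}. Grassmannian m)"

text \<open>
  The usual metric on Grassmannians, that is, the operator norm distance of orthogonal
  projections; on a subspace \<^const>\<open>closest_point\<close> is the orthogonal projection. Subspaces of
  different dimensions have distance 1, so on the union over all dimensions this metric gives the
  disjoint union topology.
\<close>

definition subspace_dist :: "'a::euclidean_space set \<Rightarrow> 'a set \<Rightarrow> real" where
  "subspace_dist V W = onorm (\<lambda>x. closest_point V x - closest_point W x)"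

definition subspaces_open :: "'a::euclidean_space set set \<Rightarrow> bool" where
  "subspaces_open B \<longleftrightarrow> B \<subseteq> all_subspaces \<and>
     (\<forall>V\<in>B. \<exists>r>0. \<forall>W\<in>all_subspaces. subspace_dist V W < r \<longrightarrow> W \<in> B)"

definition subspaces_borel :: "'a::euclidean_space set measure" where
  "subspaces_borel = sigma all_subspaces {B. subspaces_open B}"

text \<open>
  One-dimensional Hausdorff measure, normalised so that it is length on lines. Boundedness of the
  covering sets is required because \<^const>\<open>diameter\<close> is unspecified on unbounded sets.
\<close>

definition hausdorff1_pre :: "real \<Rightarrow> 'a::metric_space set \<Rightarrow> ennreal" where
  "hausdorff1_pre \<delta> A =
     (INF U\<in>{U :: nat \<Rightarrow> 'a set. A \<subseteq> (\<Union>i. U i) \<and> (\<forall>i. bounded (U i) \<and> diameter (U i) \<le> \<delta>)}.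
        \<Sum>i. ennreal (diameter (U i)))"

definition hausdorff1 :: "'a::metric_space set \<Rightarrow> ennreal" where
  "hausdorff1 A = (SUP \<delta>\<in>{0<..}. hausdorff1_pre \<delta> A)"

definition dir_cone :: "'a::euclidean_space \<Rightarrow> real \<Rightarrow> 'a set" where
  "dir_cone e \<alpha> = {x. x \<bullet> e \<ge> \<alpha> * norm x * norm e}"

definition cone_curves :: "'a::euclidean_space \<Rightarrow> real \<Rightarrow> (real \<Rightarrow> 'a) set" where
  "cone_curves e \<alpha> =
     {\<gamma>. (\<exists>L. L-lipschitz_on UNIV \<gamma>) \<and>
         (AE t in lebesgue. \<exists>d. (\<gamma> has_vector_derivative d) (at t) \<and> d \<in> dir_cone e \<alpha>)}"

definition width_open :: "'a::euclidean_space \<Rightarrow> real \<Rightarrow> 'a set \<Rightarrow> ennreal" where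
  "width_open e \<alpha> G = (SUP \<gamma>\<in>cone_curves e \<alpha>. hausdorff1 (G \<inter> range \<gamma>))"

text \<open>
  Since \<^const>\<open>width_open\<close> is monotone, both definitions agree on open sets.
\<close>

definition width :: "'a::euclidean_space \<Rightarrow> real \<Rightarrow> 'a set \<Rightarrow> ennreal" where
  "width e \<alpha> E = (INF G\<in>{G. open G \<and> E \<subseteq> G}. width_open e \<alpha> G)"

definition upper_dir_deriv :: "('a::real_normed_vector \<Rightarrow> real) \<Rightarrow> 'a \<Rightarrow> 'a \<Rightarrow> ereal" where
  "upper_dir_deriv f x v = Limsup (at_right 0) (\<lambda>t. ereal ((f (x + t *\<^sub>R v) - f x) / t))"

definition lower_dir_deriv :: "('a::real_normed_vector \<Rightarrow> real) \<Rightarrow> 'a \<Rightarrow> 'a \<Rightarrow> ereal" where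
  "lower_dir_deriv f x v = Liminf (at_right 0) (\<lambda>t. ereal ((f (x + t *\<^sub>R v) - f x) / t))"

end

theory Submission
  imports Defs
begin

text \<open>
  An open set \<open>G\<close> of small width carries a potential: the supremum of the length, measured along \<open>e\<close>,
  that curves ending near \<open>x\<close> spend in \<open>G\<close>. It is uniformly small, increases at rate 1 along \<open>e\<close>
  inside \<open>G\<close>, at a rate in \<open>[0,1]\<close> elsewhere, and is almost constant across \<open>e\<close> when \<open>\<alpha>\<close> is small.
  Smoothed and localised, such potentials change the gradient of a \<open>C\<^sup>1\<close> function by any prescribed
  field orthogonal to \<open>T\<close>, up to small errors and outside a set of small measure, while changing the
  function itself arbitrarily little.

  Iterating, the gradients at almost every \<open>x\<close> visit infinitely often neighbourhoods of
  \<open>t + a (b - P b)\<close> for each \<open>b\<close> in the basis and for \<open>b = 0\<close>, where \<open>P\<close> projects onto \<open>T x\<close>,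
  \<open>t \<in> T x\<close> and \<open>a > 0\<close>; each of them is seen by the limit function at its own scale. The tangential
  part \<open>t\<close> is uncontrolled but eventually stabilises strictly inside the ball of radius 2, because the
  bound on the \<open>k\<close>-th gradient is \<open>2 - 2\<^sup>-\<^sup>k\<close>. This leaves the room \<open>a = 2 - \<parallel>t\<parallel>\<close> and hence the
  constant \<open>c\<close>.
\<close>

section \<open>Smoothing by Steklov averages\<close>

text \<open>For \<open>u\<close> orthogonal to \<open>T x\<close> the cone around \<open>u\<close>
  meets \<open>T x\<close> only at 0, for every \<alpha> > 0. So the width hypothesis can be used
  for arbitrarily wide cones, but only around directions orthogonal to \<open>T x\<close>: wide
  cones admit curves almost orthogonal to \<open>e\<close>, and these flatten the potential across
  \<open>e\<close> to slope \<open>\<alpha> / sqrt (1 - \<alpha>\<^sup>2)\<close>. This is also why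
  the tangential part of the gradient cannot be prescribed.

  A gradient visited at step \<open>k\<close> must not be washed out by later steps. Therefore a
  scale \<open>r k\<close> is fixed at which the \<open>k\<close>-th function is nearly affine, and
  all later changes of the function together are small compared with \<open>r k\<close>.

  The target for \<open>b = 0\<close> serves as reference. Passing from it to the target for a basis
  vector \<open>b\<close> changes the slope in direction \<open>v\<close> by
  \<open>a * ((b - P b) \<bullet> v) = a * ((v - P v) \<bullet> b)\<close>, so \<open>t\<close>
  cancels, and some basis vector detects at least the fraction \<open>1 / DIM('a)\<close> of the
  distance from \<open>v\<close> to \<open>T x\<close>. The sets of small measure that are missed by
  the steps have summable measures, so Borel-Cantelli leaves only a null set.\<close>

definition has_gradient :: "('a::euclidean_space \<Rightarrow> real) \<Rightarrow> ('a \<Rightarrow> 'a) \<Rightarrow> bool" where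
  "has_gradient f p \<longleftrightarrow> continuous_on UNIV p \<and> (\<forall>x. GDERIV f x :> p x)"

lemma has_gradient_has_derivative:
  "has_gradient f p \<Longrightarrow> (f has_derivative (\<lambda>w. w \<bullet> p x)) (at x within S)"
  by (auto simp: has_gradient_def gderiv_def intro: has_derivative_at_withinI)

lemma has_gradient_continuous: "has_gradient f p \<Longrightarrow> continuous_on S f"
  by (meson continuous_at_imp_continuous_on has_derivative_continuous has_gradient_has_derivative)

lemma has_gradient_along_line:
  assumes "has_gradient f p"
  shows "((\<lambda>t. f (x + t *\<^sub>R v)) has_real_derivative v \<bullet> p (x + t *\<^sub>R v)) (at t within S)"
proof -
  have "((\<lambda>t. f (x + t *\<^sub>R v)) has_derivative (\<lambda>s. (s *\<^sub>R v) \<bullet> p (x + t *\<^sub>R v))) (at t within S)"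
    by (rule has_derivative_compose[OF _ has_gradient_has_derivative[OF assms]])
      (auto intro!: derivative_eq_intros)
  then show ?thesis
    by (simp add: has_field_derivative_def mult_commute_abs)
qed

lemma has_gradient_add:
  "has_gradient f p \<Longrightarrow> has_gradient g q \<Longrightarrow> has_gradient (\<lambda>x. f x + g x) (\<lambda>x. p x + q x)"
  by (auto simp: has_gradient_def intro: continuous_intros GDERIV_add)

lemma has_gradient_const: "has_gradient (\<lambda>x. c) (\<lambda>x. 0)"
  by (auto simp: has_gradient_def intro: continuous_intros GDERIV_const)

lemma has_gradient_mult:
  assumes "has_gradient f p" "has_gradient g q"
  shows "has_gradient (\<lambda>x. f x * g x) (\<lambda>x. f x *\<^sub>R q x + g x *\<^sub>R p x)"
  unfolding has_gradient_def
proof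
  show "continuous_on UNIV (\<lambda>x. f x *\<^sub>R q x + g x *\<^sub>R p x)"
    using assms has_gradient_continuous[of _ _ UNIV]
    by (auto simp: has_gradient_def intro!: continuous_intros)
  show "\<forall>x. GDERIV (\<lambda>x. f x * g x) x :> f x *\<^sub>R q x + g x *\<^sub>R p x"
    using assms by (auto simp: has_gradient_def intro: GDERIV_mult)
qed

lemma has_gradient_cmult:
  "has_gradient f p \<Longrightarrow> has_gradient (\<lambda>x. c * f x) (\<lambda>x. c *\<^sub>R p x)"
  using has_gradient_mult[OF has_gradient_const[of c], of f p] by simp

lemma has_gradient_sum:
  "finite I \<Longrightarrow> (\<And>i. i \<in> I \<Longrightarrow> has_gradient (f i) (p i)) \<Longrightarrow>
     has_gradient (\<lambda>x. \<Sum>i\<in>I. f i x) (\<lambda>x. \<Sum>i\<in>I. p i x)"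
  by (induction I rule: finite_induct) (auto intro: has_gradient_const has_gradient_add)

lemma has_gradient_lipschitz:
  assumes f: "has_gradient f p" and p: "\<And>x. norm (p x) \<le> M"
  shows "M-lipschitz_on UNIV f"
proof (rule bounded_derivative_imp_lipschitz)
  show "0 \<le> M"
    using p[of 0] norm_ge_zero[of "p 0"] by linarith
  show "onorm (\<lambda>w. w \<bullet> p x) \<le> M" for x
  proof (rule onorm_le)
    fix w show "norm (w \<bullet> p x) \<le> M * norm w"
      using Cauchy_Schwarz_ineq2[of w "p x"] mult_left_mono[OF p[of x], of "norm w"]
      by (simp add: mult.commute)
  qed
qed (use has_gradient_has_derivative[OF f] in auto)

lemma has_gradient_taylor:
  assumes f: "has_gradient f p" and p: "\<And>t. t \<in> {0..1} \<Longrightarrow> norm (p (x + t *\<^sub>R w) - p x) \<le> e"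
  shows "\<bar>f (x + w) - f x - p x \<bullet> w\<bar> \<le> e * norm w"
proof -
  obtain t where t: "0 < t" "t < 1"
    and eq: "f (x + 1 *\<^sub>R w) - f (x + 0 *\<^sub>R w) = (1 - 0) * (w \<bullet> p (x + t *\<^sub>R w))"
    using MVT2[OF _ has_gradient_along_line[OF f], of 0 1 x w] by auto
  have "f (x + w) - f x - p x \<bullet> w = w \<bullet> (p (x + t *\<^sub>R w) - p x)"
    using eq by (simp add: inner_diff_right inner_commute)
  also have "\<bar>\<dots>\<bar> \<le> norm w * e"
    using Cauchy_Schwarz_ineq2[of w "p (x + t *\<^sub>R w) - p x"] mult_left_mono[OF p[of t], of "norm w"] t
    by (auto intro: order_trans)
  finally show ?thesis
    by (simp add: mult.commute)
qed

text \<open>\<open>p\<close> is uniformly continuous on the ball of radius \<open>R + 1\<close>, and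
  the segment from \<open>x\<close> to \<open>x + w\<close> stays there because \<open>r\<close> is
  also chosen at most 1. The bound \<open>r \<le> e\<close> makes the scales of the iteration tend
  to 0.\<close>

lemma has_gradient_uniform_on_cball:
  assumes f: "has_gradient f p" and e: "e > 0"
  obtains r where "r > 0" "r \<le> e"
    "\<And>x w. norm x \<le> R \<Longrightarrow> norm w \<le> r \<Longrightarrow> \<bar>f (x + w) - f x - p x \<bullet> w\<bar> \<le> e * norm w"
proof -
  have "uniformly_continuous_on (cball 0 (R + 1)) p"
    using f by (intro compact_uniformly_continuous)
      (auto simp: has_gradient_def intro: continuous_on_subset)
  then obtain d where d: "d > 0"
    "\<And>x y. x \<in> cball 0 (R+1) \<Longrightarrow> y \<in> cball 0 (R+1) \<Longrightarrow> dist y x < d \<Longrightarrow> dist (p y) (p x) < e"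
    unfolding uniformly_continuous_on_def using e by meson
  define r where "r = min (min 1 e) (d / 2)"
  have r: "r > 0" "r \<le> e" "r \<le> 1" "r < d"
    using d(1) e by (auto simp: r_def)
  show ?thesis
  proof (rule that[OF r(1,2)])
    fix x w :: 'a assume x: "norm x \<le> R" and w: "norm w \<le> r"
    show "\<bar>f (x + w) - f x - p x \<bullet> w\<bar> \<le> e * norm w"
    proof (rule has_gradient_taylor[OF f])
      fix t :: real assume t: "t \<in> {0..1}"
      have tw: "norm (t *\<^sub>R w) \<le> r"
        using t w mult_mono[of t 1 "norm w" r] r by (auto simp: )
      have "dist (p (x + t *\<^sub>R w)) (p x) < e"
      proof (rule d)
        show "x + t *\<^sub>R w \<in> cball 0 (R + 1)" "x \<in> cball 0 (R + 1)"
          using x tw r norm_triangle_ineq[of x "t *\<^sub>R w"]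
          unfolding mem_cball_0 by linarith+
        show "dist (x + t *\<^sub>R w) x < d"
          using tw r(4) by (simp add: dist_norm)
      qed
      then show "norm (p (x + t *\<^sub>R w) - p x) \<le> e"
        by (simp add: dist_norm)
    qed
  qed
qed



text \<open>Increments for small positive \<open>t\<close> suffice because differentiability is
  already known: the right difference quotient converges to \<open>v \<bullet> p x\<close> and
  inherits the bounds.\<close>

lemma inner_gradient_bounds:
  assumes "has_gradient f p" and "\<epsilon> > 0"
    and "\<And>t. 0 < t \<Longrightarrow> t < \<epsilon> \<Longrightarrow> a * t \<le> f (x + t *\<^sub>R v) - f x"
    and "\<And>t. 0 < t \<Longrightarrow> t < \<epsilon> \<Longrightarrow> f (x + t *\<^sub>R v) - f x \<le> b * t"
  shows "a \<le> v \<bullet> p x" "v \<bullet> p x \<le> b"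
proof -
  have "((\<lambda>t. f (x + t *\<^sub>R v)) has_real_derivative v \<bullet> p x) (at 0 within {0<..})"
    using has_gradient_along_line[OF assms(1), of x v 0] by simp
  then have lim: "((\<lambda>t. (f (x + t *\<^sub>R v) - f x) / t) \<longlongrightarrow> v \<bullet> p x) (at_right 0)"
    by (simp add: has_field_derivative_iff)
  have ev: "\<forall>\<^sub>F t in at_right 0. 0 < t \<and> t < \<epsilon>"
    using assms(2) by (auto simp: eventually_at_right_field)
  show "a \<le> v \<bullet> p x"
    by (rule tendsto_lowerbound[OF lim])
      (use assms(3) in \<open>auto intro!: eventually_mono[OF ev] simp: le_divide_eq\<close>)
  show "v \<bullet> p x \<le> b"
    by (rule tendsto_upperbound[OF lim])
      (use assms(4) in \<open>auto intro!: eventually_mono[OF ev] simp: divide_le_eq\<close>)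
qed

section \<open>Continuous partial derivatives and averages along segments\<close>

definition has_partial :: "('a::euclidean_space \<Rightarrow> real) \<Rightarrow> 'a \<Rightarrow> ('a \<Rightarrow> real) \<Rightarrow> bool" where
  "has_partial F b G \<longleftrightarrow> continuous_on UNIV G \<and>
     (\<forall>x. ((\<lambda>t. F (x + t *\<^sub>R b)) has_real_derivative G x) (at 0))"

lemma has_partial_along_line:
  assumes "has_partial F b G"
  shows "((\<lambda>t. F (x + t *\<^sub>R b)) has_real_derivative G (x + t *\<^sub>R b)) (at t within S)"
proof -
  have "((\<lambda>s. F ((x + t *\<^sub>R b) + s *\<^sub>R b)) has_real_derivative G (x + t *\<^sub>R b)) (at 0)"
    using assms by (auto simp: has_partial_def)
  then have "((\<lambda>s. F (x + (s + t) *\<^sub>R b)) has_real_derivative G (x + t *\<^sub>R b)) (at 0)"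
    by (simp add: algebra_simps)
  then have "((\<lambda>s. F (x + s *\<^sub>R b)) has_real_derivative G (x + t *\<^sub>R b)) (at (0 + t))"
    by (subst DERIV_shift)
  then show ?thesis
    by (auto intro: has_field_derivative_at_within)
qed

text \<open>The coordinates are changed one at a time, each change being estimated by the mean value
  inequality. The intermediate points stay within \<open>norm w\<close> of \<open>x\<close> because
  the partial displacements are dominated by \<open>w\<close> coordinatewise.\<close>

lemma partials_imp_increment_bound:
  fixes F :: "'a::euclidean_space \<Rightarrow> real"
  assumes P: "\<And>b. b \<in> Basis \<Longrightarrow> has_partial F b (G b)"
    and d: "\<And>b y. b \<in> Basis \<Longrightarrow> norm (y - x) < d \<Longrightarrow> \<bar>G b y - G b x\<bar> \<le> e"
    and w: "norm w < d" and B: "B \<subseteq> Basis"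
  shows "\<bar>F (x + (\<Sum>b\<in>B. (w \<bullet> b) *\<^sub>R b)) - F x - (\<Sum>b\<in>B. (w \<bullet> b) * G b x)\<bar> \<le> e * (\<Sum>b\<in>B. \<bar>w \<bullet> b\<bar>)"
proof -
  have "finite B"
    using B finite_Basis by (rule finite_subset)
  then show ?thesis
    using B
  proof (induction B rule: finite_induct)
    case empty
    then show ?case by simp
  next
    case (insert c B)
    let ?z = "\<Sum>b\<in>B. (w \<bullet> b) *\<^sub>R b"
    have c: "c \<in> Basis"
      using insert by auto
    have "\<bar>F ((x + ?z) + (w \<bullet> c) *\<^sub>R c) - F (x + ?z) - (w \<bullet> c) * G c x\<bar> \<le> e * \<bar>w \<bullet> c\<bar>"
    proof -
      have near: "norm ((x + ?z) + t *\<^sub>R c - x) < d" if "\<bar>t\<bar> \<le> \<bar>w \<bullet> c\<bar>" for t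
      proof -
        let ?u = "?z + t *\<^sub>R c"
        have "\<bar>?u \<bullet> b\<bar> \<le> \<bar>w \<bullet> b\<bar>" if b: "b \<in> Basis" for b
        proof -
          have "?z \<bullet> b = (\<Sum>b'\<in>B. if b' = b then w \<bullet> b else 0)"
            unfolding inner_sum_left
            by (rule sum.cong) (use insert.prems b in \<open>auto simp: inner_Basis\<close>)
          also have "\<dots> = (if b \<in> B then w \<bullet> b else 0)"
            using insert.hyps by (simp add: sum.delta)
          finally show ?thesis
            using insert.hyps b c \<open>\<bar>t\<bar> \<le> \<bar>w \<bullet> c\<bar>\<close> by (auto simp: inner_add_left inner_Basis)
        qed
        then have "norm ?u \<le> norm w"
          by (rule norm_le_componentwise)
        then show ?thesis
          using w by (simp add: add.assoc)
      qed
      let ?g = "\<lambda>t. F ((x + ?z) + t *\<^sub>R c) - t * G c x"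
      have der: "(?g has_real_derivative G c ((x + ?z) + t *\<^sub>R c) - G c x) (at t within S)" for t S
        by (auto intro!: derivative_eq_intros has_partial_along_line[OF P[OF c]])
      have "norm (?g (w \<bullet> c) - ?g 0) \<le> e * norm (w \<bullet> c - 0)"
      proof (rule field_differentiable_bound[where S = "{-\<bar>w \<bullet> c\<bar>..\<bar>w \<bullet> c\<bar>}"])
        fix t assume "t \<in> {-\<bar>w \<bullet> c\<bar>..\<bar>w \<bullet> c\<bar>}"
        then show "norm (G c ((x + ?z) + t *\<^sub>R c) - G c x) \<le> e"
          using d[OF c near[of t]] by auto
      qed (auto intro: der)
      then show ?thesis
        by (simp add: algebra_simps)
    qed
    moreover have "\<bar>F (x + ?z) - F x - (\<Sum>b\<in>B. (w \<bullet> b) * G b x)\<bar> \<le> e * (\<Sum>b\<in>B. \<bar>w \<bullet> b\<bar>)"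
      using insert by auto
    ultimately show ?case
      using insert.hyps by (simp add: algebra_simps)
  qed
qed

lemma partials_imp_gradient:
  fixes F :: "'a::euclidean_space \<Rightarrow> real"
  assumes P: "\<And>b. b \<in> Basis \<Longrightarrow> has_partial F b (G b)"
  shows "has_gradient F (\<lambda>x. \<Sum>b\<in>Basis. G b x *\<^sub>R b)"
  unfolding has_gradient_def
proof (intro conjI allI)
  show "continuous_on UNIV (\<lambda>x. \<Sum>b\<in>Basis. G b x *\<^sub>R b)"
    using P by (auto simp: has_partial_def intro!: continuous_intros)
  fix x
  let ?p = "\<Sum>b\<in>Basis. G b x *\<^sub>R b"
  show "GDERIV F x :> ?p"
    unfolding gderiv_def has_derivative_at_alt
  proof (intro conjI allI impI)
    show "bounded_linear (\<lambda>h. h \<bullet> ?p)"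
      by (rule bounded_linear_inner_left)
    fix e :: real assume e: "0 < e"
    \<comment> \<open>Each coordinate of a displacement is at most its norm, so the sum of their
      absolute values costs a factor \<open>DIM('a)\<close>.\<close>
    define e' where "e' = e / DIM('a)"
    have e': "e' > 0"
      using e by (simp add: e'_def)
    have "\<exists>d>0. \<forall>y. norm (y - x) < d \<longrightarrow> \<bar>G b y - G b x\<bar> \<le> e'" if "b \<in> Basis" for b
    proof -
      have "isCont (G b) x"
        using P[OF that] by (simp add: has_partial_def continuous_on_eq_continuous_at)
      then show ?thesis
        using e' unfolding continuous_at_eps_delta dist_norm by (metis less_imp_le real_norm_def)
    qed
    then obtain d where d: "\<And>b. b \<in> Basis \<Longrightarrow> d b > 0"
      "\<And>b y. b \<in> Basis \<Longrightarrow> norm (y - x) < d b \<Longrightarrow> \<bar>G b y - G b x\<bar> \<le> e'"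
      by metis
    define D where "D = Min (d ` Basis)"
    have D: "D > 0" "\<And>b. b \<in> Basis \<Longrightarrow> D \<le> d b"
      using d(1) by (auto simp: D_def)
    have "norm (F y - F x - (y - x) \<bullet> ?p) \<le> e * norm (y - x)" if "norm (y - x) < D" for y
    proof -
      let ?w = "y - x"
      have "\<bar>F (x + (\<Sum>b\<in>Basis. (?w \<bullet> b) *\<^sub>R b)) - F x - (\<Sum>b\<in>Basis. (?w \<bullet> b) * G b x)\<bar>
            \<le> e' * (\<Sum>b\<in>Basis. \<bar>?w \<bullet> b\<bar>)"
        by (rule partials_imp_increment_bound[OF P, where d = D])
          (use d(2) D(2) that in \<open>auto dest: less_le_trans\<close>)
      also have "\<dots> \<le> e' * (\<Sum>b\<in>(Basis::'a set). norm ?w)"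
        using e' by (intro mult_left_mono sum_mono) (auto simp: Basis_le_norm)
      also have "\<dots> = e * norm ?w"
        by (simp add: e'_def)
      finally show ?thesis
        by (simp add: euclidean_representation inner_sum_right mult.commute)
    qed
    then show "\<exists>d>0. \<forall>y. norm (y - x) < d \<longrightarrow> norm (F y - F x - (y - x) \<bullet> ?p) \<le> e * norm (y - x)"
      using D(1) by blast
  qed
qed

text \<open>
  This abstracts all that is needed of averages of \<open>F\<close> over translations of length at most \<open>\<rho>\<close>; unlike
  an explicit formula, it composes.
\<close>

definition averages :: "real \<Rightarrow> ('a::euclidean_space \<Rightarrow> real) \<Rightarrow> ('a \<Rightarrow> real) \<Rightarrow> bool" where
  "averages \<rho> F g \<longleftrightarrow> (\<forall>x y a c d.
     (\<forall>w. norm w \<le> \<rho> \<longrightarrow> a * F (y + w) + c * F (x + w) \<le> d) \<longrightarrow> a * g y + c * g x \<le> d)"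

lemma averagesD:
  assumes "averages \<rho> F g" and "\<And>w. norm w \<le> \<rho> \<Longrightarrow> a * F (y + w) + c * F (x + w) \<le> d"
  shows "a * g y + c * g x \<le> d"
  using assms unfolding averages_def by blast

lemma averages_value:
  assumes "averages \<rho> F g"
  shows "(\<And>w. norm w \<le> \<rho> \<Longrightarrow> F (x + w) \<le> d) \<Longrightarrow> g x \<le> d"
    and "(\<And>w. norm w \<le> \<rho> \<Longrightarrow> d \<le> F (x + w)) \<Longrightarrow> d \<le> g x"
  using averagesD[OF assms, of 1 x 0 x d] averagesD[OF assms, of "-1" x 0 x "-d"] by auto

text \<open>Coefficients 1 and -1 in \<open>averages\<close>: both points are shifted by the same
  \<open>w\<close>, so bounds on increments, not only on values, pass to the average. The slope
  estimates for smoothed functions rest on this.\<close>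

lemma averages_diff:
  assumes "averages \<rho> F g"
  shows "(\<And>w. norm w \<le> \<rho> \<Longrightarrow> F (y + w) - F (x + w) \<le> d) \<Longrightarrow> g y - g x \<le> d"
    and "(\<And>w. norm w \<le> \<rho> \<Longrightarrow> d \<le> F (y + w) - F (x + w)) \<Longrightarrow> d \<le> g y - g x"
  using averagesD[OF assms, of 1 y "-1" x d] averagesD[OF assms, of "-1" y 1 x "-d"] by force+

text \<open>One such average creates a continuous partial derivative in the direction
  \<open>b\<close> only, so it is applied once for each basis vector.\<close>

definition steklov :: "real \<Rightarrow> 'a \<Rightarrow> ('a::euclidean_space \<Rightarrow> real) \<Rightarrow> 'a \<Rightarrow> real" where
  "steklov h b F x = integral {0..1} (\<lambda>s. F (x + (h * s) *\<^sub>R b))"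

lemma steklov_integrable:
  fixes F :: "'a::euclidean_space \<Rightarrow> real"
  assumes "continuous_on UNIV F"
  shows "(\<lambda>s. F (x + (h * s) *\<^sub>R b)) integrable_on {0..1::real}"
  by (intro integrable_continuous_interval continuous_on_compose2[OF assms])
    (auto intro!: continuous_intros)

lemma continuous_on_steklov:
  assumes "continuous_on UNIV F"
  shows "continuous_on UNIV (steklov h b F)"
proof -
  have "continuous_on (UNIV \<times> cbox 0 1) (\<lambda>(x, s::real). F (x + (h * s) *\<^sub>R b))"
    unfolding split_beta
    by (intro continuous_on_compose2[OF assms]) (auto intro!: continuous_intros)
  then show ?thesis
    using integral_continuous_on_param[of UNIV 0 1 "\<lambda>x s. F (x + (h * s) *\<^sub>R b)"]
    by (simp add: steklov_def[abs_def])
qed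

lemma averages_steklov:
  assumes F: "continuous_on UNIV F" and h: "0 \<le> h" and b: "norm b = 1"
  shows "averages h F (steklov h b F)"
  unfolding averages_def
proof (intro allI impI)
  fix x y a c d
  assume *: "\<forall>w. norm w \<le> h \<longrightarrow> a * F (y + w) + c * F (x + w) \<le> d"
  have "a * steklov h b F y + c * steklov h b F x
      = integral {0..1} (\<lambda>s. a * F (y + (h * s) *\<^sub>R b) + c * F (x + (h * s) *\<^sub>R b))"
    unfolding steklov_def
    by (subst integral_add) (auto intro!: steklov_integrable F integrable_on_mult_right)
  also have "\<dots> \<le> integral {0..1::real} (\<lambda>s. d)"
  proof (rule integral_le)
    show "(\<lambda>s. a * F (y + (h * s) *\<^sub>R b) + c * F (x + (h * s) *\<^sub>R b)) integrable_on {0..1}"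
      by (auto intro!: integrable_add steklov_integrable F integrable_on_mult_right)
    fix s :: real assume "s \<in> {0..1}"
    then have "norm ((h * s) *\<^sub>R b) \<le> h"
      using h b mult_left_mono[of s 1 h] by simp
    then show "a * F (y + (h * s) *\<^sub>R b) + c * F (x + (h * s) *\<^sub>R b) \<le> d"
      using * by blast
  qed auto
  finally show "a * steklov h b F y + c * steklov h b F x \<le> d"
    by simp
qed

text \<open>Differentiation under the integral sign. It ensures that a further average keeps the
  partial derivatives produced by earlier ones.\<close>

lemma has_partial_steklov_other:
  assumes F: "continuous_on UNIV F" and P: "has_partial F c G"
  shows "has_partial (steklov h b F) c (steklov h b G)"
  unfolding has_partial_def
proof (intro conjI allI)
  have G: "continuous_on UNIV G"
    using P by (simp add: has_partial_def)
  show "continuous_on UNIV (steklov h b G)"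
    by (rule continuous_on_steklov[OF G])
  fix x
  have "((\<lambda>t. integral (cbox 0 1) (\<lambda>s. F ((x + t *\<^sub>R c) + (h * s) *\<^sub>R b)))
      has_real_derivative integral (cbox 0 1) (\<lambda>s. G ((x + 0 *\<^sub>R c) + (h * s) *\<^sub>R b))) (at 0 within UNIV)"
  proof (rule leibniz_rule_field_derivative[where fx = "\<lambda>t s. G ((x + t *\<^sub>R c) + (h * s) *\<^sub>R b)"])
    fix t s :: real
    show "((\<lambda>t. F ((x + t *\<^sub>R c) + (h * s) *\<^sub>R b)) has_real_derivative G ((x + t *\<^sub>R c) + (h * s) *\<^sub>R b))
        (at t within UNIV)"
      using has_partial_along_line[OF P, of "x + (h * s) *\<^sub>R b" t UNIV] by (simp add: algebra_simps)
  next
    show "continuous_on (UNIV \<times> cbox 0 1) (\<lambda>(t, s). G ((x + t *\<^sub>R c) + (h * s) *\<^sub>R b))"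
      unfolding split_beta
      by (intro continuous_on_compose2[OF G]) (auto intro!: continuous_intros)
  qed (use steklov_integrable[OF F] in auto)
  then show "((\<lambda>t. steklov h b F (x + t *\<^sub>R c)) has_real_derivative steklov h b G x) (at 0)"
    by (simp add: steklov_def)
qed

text \<open>Restricted to a line in direction \<open>b\<close>, the average is a difference quotient
  of an antiderivative of \<open>F\<close>, so continuity of \<open>F\<close> is enough.\<close>

lemma has_partial_steklov_self:
  assumes F: "continuous_on UNIV F" and h: "h > 0"
  shows "has_partial (steklov h b F) b (\<lambda>x. (F (x + h *\<^sub>R b) - F x) / h)"
  unfolding has_partial_def
proof (intro conjI allI)
  show "continuous_on UNIV (\<lambda>x. (F (x + h *\<^sub>R b) - F x) / h)"
    using h by (auto intro!: continuous_intros continuous_on_compose2[OF F])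
  fix x
  define \<phi> where "\<phi> r = F (x + r *\<^sub>R b)" for r
  have \<phi>: "continuous_on S \<phi>" for S
    unfolding \<phi>_def by (intro continuous_on_compose2[OF F]) (auto intro!: continuous_intros)
  \<comment> \<open>The arguments \<open>t + h * s\<close> with \<bar>t\<bar> < 1 and 0 \<le> s
    \<le> 1 must lie in the interior of this interval, where the derivative is two-sided.\<close>
  obtain \<Phi> where \<Phi>0: "\<And>r. r \<in> {-2..2+h} \<Longrightarrow> (\<Phi> has_vector_derivative \<phi> r) (at r within {-2..2+h})"
    using antiderivative_continuous[OF \<phi>] by metis
  have \<Phi>: "(\<Phi> has_real_derivative \<phi> r) (at r)" if "-2 < r" "r < 2 + h" for r
    using \<Phi>0[of r] that at_within_Icc_at[of "-2" r "2 + h"]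
    by (auto simp: has_real_derivative_iff_has_vector_derivative)
  have eq: "steklov h b F (x + t *\<^sub>R b) = (\<Phi> (t + h) - \<Phi> t) / h" if "\<bar>t\<bar> < 1" for t
  proof -
    have "((\<lambda>s. \<phi> (t + h * s)) has_integral \<Phi> (t + h * 1) / h - \<Phi> (t + h * 0) / h) {0..1}"
    proof (rule fundamental_theorem_of_calculus)
      fix s :: real assume s: "s \<in> {0..1}"
      have "0 \<le> h * s" "h * s \<le> h"
        using s h mult_left_mono[of s 1 h] by auto
      then have "-2 < t + h * s" "t + h * s < 2 + h"
        using that by linarith+
      then have "((\<lambda>s. \<Phi> (t + h * s)) has_real_derivative \<phi> (t + h * s) * h) (at s within {0..1})"
        by (intro DERIV_chain2[where f = \<Phi> and g = "\<lambda>s. t + h * s", OF \<Phi>])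
          (auto intro!: derivative_eq_intros)
      then have "((\<lambda>s. \<Phi> (t + h * s) / h) has_real_derivative \<phi> (t + h * s)) (at s within {0..1})"
        using h by (auto intro!: derivative_eq_intros)
      then show "((\<lambda>s. \<Phi> (t + h * s) / h) has_vector_derivative \<phi> (t + h * s)) (at s within {0..1})"
        by (simp add: has_real_derivative_iff_has_vector_derivative)
    qed simp
    then show ?thesis
      by (simp add: steklov_def \<phi>_def algebra_simps diff_divide_distrib integral_unique)
  qed
  have "((\<lambda>t. (\<Phi> (t + h) - \<Phi> t) / h) has_real_derivative (\<phi> (0 + h) - \<phi> 0) / h) (at 0)"
    using h DERIV_shift[of \<Phi> "\<phi> h" 0 h]
    by (auto intro!: derivative_eq_intros \<Phi>)
  moreover have "\<forall>\<^sub>F t in nhds 0. (\<Phi> (t + h) - \<Phi> t) / h = steklov h b F (x + t *\<^sub>R b)"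
    using eq by (auto simp: eventually_nhds_metric dist_real_def intro!: exI[of _ 1])
  ultimately have "((\<lambda>t. steklov h b F (x + t *\<^sub>R b)) has_real_derivative (\<phi> (0 + h) - \<phi> 0) / h) (at 0)"
    by (rule DERIV_cong_ev[THEN iffD1, OF refl _ refl, rotated])
  then show "((\<lambda>t. steklov h b F (x + t *\<^sub>R b)) has_real_derivative (F (x + h *\<^sub>R b) - F x) / h) (at 0)"
    by (simp add: \<phi>_def)
qed

lemma averages_trans:
  assumes "averages r F g" "averages s g k"
  shows "averages (r + s) F k"
  unfolding averages_def
proof (intro allI impI)
  fix x y a c d
  assume *: "\<forall>w. norm w \<le> r + s \<longrightarrow> a * F (y + w) + c * F (x + w) \<le> d"
  show "a * k y + c * k x \<le> d"
  proof (rule averagesD[OF assms(2)])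
    fix v :: 'a assume v: "norm v \<le> s"
    show "a * g (y + v) + c * g (x + v) \<le> d"
    proof (rule averagesD[OF assms(1)])
      fix w :: 'a assume "norm w \<le> r"
      then have "norm (v + w) \<le> r + s"
        using v norm_triangle_ineq[of v w] by linarith
      then show "a * F (y + v + w) + c * F (x + v + w) \<le> d"
        using * by (auto simp: add.assoc)
    qed
  qed
qed

text \<open>Induction over the basis vectors. Half of the radius is left to the earlier averages and
  half is used by the new one; the radii add by \<open>averages_trans\<close>.\<close>

proposition smoothing:
  fixes F :: "'a::euclidean_space \<Rightarrow> real"
  assumes F: "continuous_on UNIV F" and \<rho>: "\<rho> > 0"
  obtains g p where "has_gradient g p" "averages \<rho> F g"
proof -
  have "\<exists>g. continuous_on UNIV g \<and> averages \<rho> F g \<and> (\<forall>b\<in>B. \<exists>G. has_partial g b G)"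
    if "finite B" "B \<subseteq> Basis" for B
    using that \<rho>
  proof (induction B arbitrary: \<rho> rule: finite_induct)
    case empty
    have "averages \<rho> F F"
      using empty unfolding averages_def by (metis add.right_neutral less_imp_le norm_zero)
    then show ?case
      using F by auto
  next
    case (insert b B)
    have "\<exists>g. continuous_on UNIV g \<and> averages (\<rho>/2) F g \<and> (\<forall>b\<in>B. \<exists>G. has_partial g b G)"
      by (rule insert.IH) (use insert.prems in auto)
    then obtain g where g: "continuous_on UNIV g" "averages (\<rho>/2) F g"
      "\<And>b. b \<in> B \<Longrightarrow> \<exists>G. has_partial g b G"
      by blast
    let ?k = "steklov (\<rho>/2) b g"
    have "averages (\<rho>/2 + \<rho>/2) F ?k"
      by (rule averages_trans[OF g(2) averages_steklov[OF g(1)]]) (use insert.prems in auto)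
    moreover have "\<exists>G. has_partial ?k c G" if "c \<in> insert b B" for c
      using that has_partial_steklov_self[OF g(1), of "\<rho>/2" b] has_partial_steklov_other[OF g(1)]
        g(3) insert.prems by (metis half_gt_zero insertE)
    ultimately show ?case
      using continuous_on_steklov[OF g(1)] by (intro exI[of _ ?k]) auto
  qed
  from this[OF finite_Basis] obtain g G where "averages \<rho> F g"
    "\<And>b. b \<in> Basis \<Longrightarrow> has_partial g b (G b)"
    by (metis order_refl)
  then show thesis
    using that partials_imp_gradient by blast
qed

section \<open>A potential of small oscillation\<close>

text \<open>Projection to the line along \<open>e\<close> does not increase distances, so a cover of
  \<open>A\<close> projects into intervals no longer than the diameters. The scale 1 is enough,
  because \<open>hausdorff1\<close> dominates the premeasure at every scale. The shift
  \<open>c\<close> relates the parameter of a graph curve to its height.\<close>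

lemma emeasure_projection_le_hausdorff1:
  fixes A :: "'a::euclidean_space set"
  assumes e: "norm e = 1" and S: "S \<in> sets borel" "S \<subseteq> (\<lambda>a. a \<bullet> e - c) ` A"
  shows "emeasure lborel S \<le> hausdorff1 A"
proof -
  have "emeasure lborel S \<le> hausdorff1_pre 1 A"
    unfolding hausdorff1_pre_def
  proof (rule INF_greatest)
    fix U :: "nat \<Rightarrow> 'a set"
    assume "U \<in> {U. A \<subseteq> (\<Union>i. U i) \<and> (\<forall>i. bounded (U i) \<and> diameter (U i) \<le> 1)}"
    then have U: "A \<subseteq> (\<Union>i. U i)" "\<And>i. bounded (U i)"
      by auto
    define P where "P i = (\<lambda>a. a \<bullet> e - c) ` U i" for i
    define I where "I i = (if U i = {} then {} else {Inf (P i)..Sup (P i)})" for i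
    have bP: "bdd_above (P i)" "bdd_below (P i)" for i
    proof -
      have "bounded ((\<lambda>r. - c + r) ` (\<lambda>a. a \<bullet> e) ` U i)"
        by (intro bounded_translation bounded_linear_image[OF U(2) bounded_linear_inner_left])
      then have "bounded (P i)"
        by (simp add: P_def image_image)
      then show "bdd_above (P i)" "bdd_below (P i)"
        by (auto intro: bounded_imp_bdd_above bounded_imp_bdd_below)
    qed
    have le: "x \<bullet> e - diameter (U i) \<le> y \<bullet> e" if "x \<in> U i" "y \<in> U i" for i x y
    proof -
      have "(x - y) \<bullet> e \<le> norm (x - y)"
        using norm_cauchy_schwarz[of "x - y" e] e by simp
      also have "\<dots> \<le> diameter (U i)"
        using diameter_bounded_bound[OF U(2) that] by (simp add: dist_norm)
      finally show ?thesis
        by (simp add: inner_diff_left)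
    qed
    have I_le: "emeasure lborel (I i) \<le> ennreal (diameter (U i))" for i
    proof (cases "U i = {}")
      case False
      then have ne: "P i \<noteq> {}"
        by (auto simp: P_def)
      have "Sup (P i) - diameter (U i) \<le> y" if y: "y \<in> P i" for y
      proof -
        have "Sup (P i) \<le> y + diameter (U i)"
          using le y by (intro cSup_least[OF ne]) (force simp: P_def)
        then show ?thesis by simp
      qed
      then have "Sup (P i) - diameter (U i) \<le> Inf (P i)"
        by (intro cInf_greatest[OF ne])
      moreover have "Inf (P i) \<le> Sup (P i)"
        using ne bP by (intro cInf_le_cSup)
      ultimately show ?thesis
        using False by (auto simp: I_def intro!: ennreal_leI)
    qed (simp add: I_def)
    have "S \<subseteq> (\<Union>i. I i)"
    proof
      fix s assume "s \<in> S"
      then obtain a i where a: "a \<in> U i" "s = a \<bullet> e - c"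
        using S U by blast
      then have "s \<in> P i"
        by (auto simp: P_def)
      then have "s \<in> I i"
        using a bP[of i] by (auto simp: I_def intro: cInf_lower cSup_upper)
      then show "s \<in> (\<Union>i. I i)"
        by blast
    qed
    moreover have I: "I i \<in> sets borel" for i
      by (simp add: I_def)
    ultimately have "emeasure lborel S \<le> emeasure lborel (\<Union>i. I i)"
      by (intro emeasure_mono) auto
    also have "\<dots> \<le> (\<Sum>i. emeasure lborel (I i))"
      using I by (intro emeasure_subadditive_countably) auto
    also have "\<dots> \<le> (\<Sum>i. ennreal (diameter (U i)))"
      by (intro suminf_le I_le) auto
    finally show "emeasure lborel S \<le> (\<Sum>i. ennreal (diameter (U i)))" .
  qed
  also have "\<dots> \<le> hausdorff1 A"
    unfolding hausdorff1_def by (rule SUP_upper) simp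
  finally show ?thesis .
qed

text \<open>
  Up to a translation, these are graphs of Lipschitz maps from the line spanned by \<open>e\<close> to its
  orthogonal complement. Allowing only finitely many points of non-differentiability makes the almost
  everywhere differentiability of Lipschitz curves unnecessary.
\<close>

definition graph_curves :: "'a::euclidean_space \<Rightarrow> real \<Rightarrow> (real \<Rightarrow> 'a) set" where
  "graph_curves e L = {\<gamma>.
     (\<forall>s t. s \<le> t \<longrightarrow> (\<gamma> t - \<gamma> s) \<bullet> e = t - s \<and>
        norm (\<gamma> t - \<gamma> s - (t - s) *\<^sub>R e) \<le> L * (t - s)) \<and>
     (\<exists>F. finite F \<and> (\<forall>t. t \<notin> F \<longrightarrow> \<gamma> differentiable (at t)))}"

lemma graph_curvesD:
  assumes "\<gamma> \<in> graph_curves e L" "s \<le> t"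
  shows "(\<gamma> t - \<gamma> s) \<bullet> e = t - s" "norm (\<gamma> t - \<gamma> s - (t - s) *\<^sub>R e) \<le> L * (t - s)"
  using assms unfolding graph_curves_def by blast+

lemma graph_curves_lipschitz:
  assumes \<gamma>: "\<gamma> \<in> graph_curves e L" and e: "norm e = 1" and L: "0 \<le> L"
  shows "(1 + L)-lipschitz_on UNIV \<gamma>"
proof (rule lipschitz_onI)
  have *: "dist (\<gamma> s) (\<gamma> t) \<le> (1 + L) * (t - s)" if "s \<le> t" for s t
  proof -
    have "norm (\<gamma> t - \<gamma> s) \<le> norm (\<gamma> t - \<gamma> s - (t - s) *\<^sub>R e) + norm ((t - s) *\<^sub>R e)"
      using norm_triangle_ineq[of "\<gamma> t - \<gamma> s - (t - s) *\<^sub>R e" "(t - s) *\<^sub>R e"] by simp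
    also have "\<dots> \<le> L * (t - s) + (t - s)"
      using graph_curvesD(2)[OF \<gamma> that] e that by simp
    finally show ?thesis
      by (simp add: dist_norm norm_minus_commute algebra_simps)
  qed
  show "dist (\<gamma> s) (\<gamma> t) \<le> (1 + L) * dist s t" for s t
    using *[of s t] *[of t s] by (cases "s \<le> t") (auto simp: dist_real_def dist_commute)
qed (use L in simp)

text \<open>Pythagoras. If \<alpha> is the cosine of the half-angle of the cone,
  \<open>sqrt (1 - \<alpha>\<^sup>2) / \<alpha>\<close> is its tangent, hence the largest slope over
  the axis that the cone permits.\<close>

lemma norm_le_of_graph_slope:
  fixes d :: "'a::real_inner"
  assumes \<alpha>: "0 < \<alpha>" "\<alpha> < 1" and e: "norm e = 1"
    and d: "d \<bullet> e = 1" "norm (d - e) \<le> sqrt (1 - \<alpha>\<^sup>2) / \<alpha>"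
  shows "\<alpha> * norm d \<le> 1"
proof -
  have ee: "e \<bullet> e = 1"
    using e by (simp add: dot_square_norm)
  have "(norm d)\<^sup>2 = 1 + (norm (d - e))\<^sup>2"
    using d(1) ee by (simp add: power2_norm_eq_inner inner_diff_left inner_diff_right inner_commute)
  also have "\<dots> \<le> 1 + (sqrt (1 - \<alpha>\<^sup>2) / \<alpha>)\<^sup>2"
    using d(2) by (intro add_left_mono power_mono) auto
  also have "(sqrt (1 - \<alpha>\<^sup>2) / \<alpha>)\<^sup>2 = (1 - \<alpha>\<^sup>2) / \<alpha>\<^sup>2"
    using \<alpha> by (simp add: power_divide power_le_one)
  also have "1 + (1 - \<alpha>\<^sup>2) / \<alpha>\<^sup>2 = 1 / \<alpha>\<^sup>2"
    using \<alpha> by (simp add: field_simps)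
  finally have "(\<alpha> * norm d)\<^sup>2 \<le> 1\<^sup>2"
    using \<alpha> by (simp add: power_mult_distrib field_simps)
  then show ?thesis
    by (rule power2_le_imp_le) simp
qed

text \<open>Where the derivative exists, it is a limit of right difference quotients, which lie in a
  closed subset of the cone. The finitely many other points form a null set.\<close>

lemma graph_curves_subset_cone_curves:
  assumes \<alpha>: "0 < \<alpha>" "\<alpha> < 1" and e: "norm e = 1"
  shows "graph_curves e (sqrt (1 - \<alpha>\<^sup>2) / \<alpha>) \<subseteq> cone_curves e \<alpha>"
proof
  define L where "L = sqrt (1 - \<alpha>\<^sup>2) / \<alpha>"
  have L: "0 \<le> L"
    using \<alpha> by (simp add: L_def power_le_one)
  fix \<gamma> assume "\<gamma> \<in> graph_curves e (sqrt (1 - \<alpha>\<^sup>2) / \<alpha>)"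
  then have \<gamma>: "\<gamma> \<in> graph_curves e L"
    by (simp add: L_def)
  then obtain F where F: "finite F" "\<And>t. t \<notin> F \<Longrightarrow> \<gamma> differentiable (at t)"
    unfolding graph_curves_def by blast
  have "\<exists>d. (\<gamma> has_vector_derivative d) (at t) \<and> d \<in> dir_cone e \<alpha>" if t: "t \<notin> F" for t
  proof -
    obtain d where d: "(\<gamma> has_vector_derivative d) (at t)"
      using F(2)[OF t] by (auto simp: vector_derivative_works)
    have "(\<gamma> has_derivative (\<lambda>s. s *\<^sub>R d)) (at t within {t<..})"
      using d unfolding has_vector_derivative_def by (rule has_derivative_at_withinI)
    then have "((\<lambda>s. (1 / norm (s - t)) *\<^sub>R (\<gamma> s - (\<gamma> t + (s - t) *\<^sub>R d)) + d) \<longlongrightarrow> 0 + d) (at_right t)"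
      unfolding has_derivative_within by (intro tendsto_add tendsto_const) auto
    moreover have "\<forall>\<^sub>F s in at_right t. (1 / norm (s - t)) *\<^sub>R (\<gamma> s - (\<gamma> t + (s - t) *\<^sub>R d)) + d
        = (1 / (s - t)) *\<^sub>R (\<gamma> s - \<gamma> t)"
      by (rule eventually_at_rightI[of t "t + 1"]) (auto simp: scaleR_diff_right scaleR_add_right)
    ultimately have lim: "((\<lambda>s. (1 / (s - t)) *\<^sub>R (\<gamma> s - \<gamma> t)) \<longlongrightarrow> d) (at_right t)"
      by (simp add: tendsto_cong)
    have ev: "\<forall>\<^sub>F s in at_right t. (1 / (s - t)) *\<^sub>R (\<gamma> s - \<gamma> t) \<in> {w. w \<bullet> e = 1 \<and> norm (w - e) \<le> L}"
    proof (rule eventually_at_rightI[of t "t + 1"])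
      fix s assume "s \<in> {t<..<t + 1}"
      then have s: "t < s" by simp
      have "(1 / (s - t)) *\<^sub>R (\<gamma> s - \<gamma> t) - e = (1 / (s - t)) *\<^sub>R (\<gamma> s - \<gamma> t - (s - t) *\<^sub>R e)"
        using s by (simp add: scaleR_diff_right)
      then have "norm ((1 / (s - t)) *\<^sub>R (\<gamma> s - \<gamma> t) - e) = norm (\<gamma> s - \<gamma> t - (s - t) *\<^sub>R e) / (s - t)"
        using s by simp
      also have "\<dots> \<le> L"
        using s graph_curvesD(2)[OF \<gamma>, of t s] by (simp add: pos_divide_le_eq)
      finally show "(1 / (s - t)) *\<^sub>R (\<gamma> s - \<gamma> t) \<in> {w. w \<bullet> e = 1 \<and> norm (w - e) \<le> L}"
        using s graph_curvesD(1)[OF \<gamma>, of t s] by simp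
    qed simp
    have "closed {w. w \<bullet> e = 1 \<and> norm (w - e) \<le> L}"
      by (intro closed_Collect_conj closed_Collect_eq closed_Collect_le continuous_intros)
    then have "d \<in> {w. w \<bullet> e = 1 \<and> norm (w - e) \<le> L}"
      by (rule Lim_in_closed_set[OF _ ev _ lim]) simp
    then have "d \<in> dir_cone e \<alpha>"
      using norm_le_of_graph_slope[OF \<alpha> e, of d] e by (simp add: dir_cone_def L_def)
    then show ?thesis
      using d by blast
  qed
  moreover have "AE t in lebesgue. t \<notin> F"
    using F(1) by (intro AE_not_in) (simp add: negligible_iff_null_sets[symmetric] negligible_finite)
  ultimately have "AE t in lebesgue. \<exists>d. (\<gamma> has_vector_derivative d) (at t) \<and> d \<in> dir_cone e \<alpha>"
    by (auto elim: eventually_mono)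
  then show "\<gamma> \<in> cone_curves e \<alpha>"
    using graph_curves_lipschitz[OF \<gamma> e L] by (auto simp: cone_curves_def)
qed

lemma graph_curves_line:
  assumes "norm e = 1" "0 \<le> L"
  shows "(\<lambda>s. x + (s - r) *\<^sub>R e) \<in> graph_curves e L"
proof -
  have "e \<bullet> e = 1"
    using assms by (simp add: dot_square_norm)
  then show ?thesis
    using assms unfolding graph_curves_def
    by (auto simp: inner_diff_left inner_add_left simp flip: scaleR_diff_left
        intro!: exI[of _ "{}"] derivative_intros)
qed

text \<open>Cutting at \<open>b\<close> and continuing on a ray creates at most one new corner. No
  other modification of curves is used.\<close>

lemma graph_curves_extend:
  assumes \<gamma>: "\<gamma> \<in> graph_curves e L" and d: "d \<bullet> e = 1" "norm (d - e) \<le> L"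
  shows "(\<lambda>s. if s \<le> b then \<gamma> s else \<gamma> b + (s - b) *\<^sub>R d) \<in> graph_curves e L" (is "?\<gamma> \<in> _")
proof -
  have slope: "norm ((b' - a') *\<^sub>R d - (b' - a') *\<^sub>R e) \<le> L * (b' - a')" if "a' \<le> b'" for a' b' :: real
  proof -
    have "norm ((b' - a') *\<^sub>R d - (b' - a') *\<^sub>R e) = (b' - a') * norm (d - e)"
      using that by (simp flip: scaleR_diff_right)
    then show ?thesis
      using d(2) that by (simp add: mult.commute[of L] mult_left_mono)
  qed
  have graph: "(?\<gamma> t - ?\<gamma> s) \<bullet> e = t - s \<and> norm (?\<gamma> t - ?\<gamma> s - (t - s) *\<^sub>R e) \<le> L * (t - s)" if st: "s \<le> t" for s t
  proof -
    consider "t \<le> b" | "s \<le> b" "b < t" | "b < s" using st by linarith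
    then show ?thesis
    proof cases
      case 1
      then show ?thesis
        using graph_curvesD[OF \<gamma> st] st by simp
    next
      case 2
      have eq: "?\<gamma> t - ?\<gamma> s = (\<gamma> b - \<gamma> s) + (t - b) *\<^sub>R d"
        using 2 by simp
      have "?\<gamma> t - ?\<gamma> s - (t - s) *\<^sub>R e = (\<gamma> b - \<gamma> s - (b - s) *\<^sub>R e) + ((t - b) *\<^sub>R d - (t - b) *\<^sub>R e)"
        unfolding eq by (simp add: algebra_simps)
      also have "norm \<dots> \<le> L * (b - s) + L * (t - b)"
        using 2 slope[of b t] graph_curvesD(2)[OF \<gamma> 2(1)]
        by (intro norm_triangle_le) auto
      finally have "norm (?\<gamma> t - ?\<gamma> s - (t - s) *\<^sub>R e) \<le> L * (t - s)"
        by (simp add: algebra_simps)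
      moreover have "(?\<gamma> t - ?\<gamma> s) \<bullet> e = t - s"
        unfolding eq using graph_curvesD(1)[OF \<gamma> 2(1)] d(1) by (simp add: inner_add_left)
      ultimately show ?thesis by blast
    next
      case 3
      then have "?\<gamma> t - ?\<gamma> s = (t - s) *\<^sub>R d"
        using st by (simp add: algebra_simps)
      then show ?thesis
        using d(1) slope[OF st] by simp
    qed
  qed
  obtain F where F: "finite F" "\<And>t. t \<notin> F \<Longrightarrow> \<gamma> differentiable (at t)"
    using \<gamma> unfolding graph_curves_def by blast
  have "?\<gamma> differentiable (at t)" if t: "t \<notin> insert b F" for t
  proof (cases "t < b")
    case True
    obtain D where "(\<gamma> has_derivative D) (at t)"
      using F(2)[of t] t by (auto simp: differentiable_def)
    then have "(?\<gamma> has_derivative D) (at t)"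
      by (rule has_derivative_transform_within_open[of _ _ _ _ "{..<b}"]) (use True in auto)
    then show ?thesis
      by (auto simp: differentiable_def)
  next
    case False
    have "((\<lambda>s. \<gamma> b + (s - b) *\<^sub>R d) has_derivative (\<lambda>s. s *\<^sub>R d)) (at t)"
      by (auto intro!: derivative_eq_intros)
    then have "(?\<gamma> has_derivative (\<lambda>s. s *\<^sub>R d)) (at t)"
      by (rule has_derivative_transform_within_open[of _ _ _ _ "{b<..}"]) (use False t in auto)
    then show ?thesis
      by (auto simp: differentiable_def)
  qed
  then have "\<exists>F. finite F \<and> (\<forall>t. t \<notin> F \<longrightarrow> ?\<gamma> differentiable (at t))"
    using F(1) by (intro exI[of _ "insert b F"]) auto
  then show ?thesis
    using graph unfolding graph_curves_def by blast
qed

section \<open>The potential of a thin open set\<close>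

locale thin_open_set =
  fixes G :: "'a::euclidean_space set" and e :: 'a and L \<epsilon> :: real
  assumes openG: "open G" and unit: "norm e = 1" and L: "0 < L" and \<epsilon>: "0 < \<epsilon>"
    and thin: "\<And>\<gamma>. \<gamma> \<in> graph_curves e L \<Longrightarrow> emeasure lborel {s. \<gamma> s \<in> G} \<le> ennreal \<epsilon>"
begin

lemma ee: "e \<bullet> e = 1"
  using unit by (simp add: dot_square_norm)

text \<open>The parameter of a graph curve grows like its height, so Lebesgue measure of this set is
  length measured along \<open>e\<close>.\<close>

definition passed :: "(real \<Rightarrow> 'a) \<Rightarrow> real \<Rightarrow> real set" where
  "passed \<gamma> b = {s. s \<le> b \<and> \<gamma> s \<in> G}"

lemma passed_fmeasurable:
  assumes "\<gamma> \<in> graph_curves e L"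
  shows "passed \<gamma> b \<in> fmeasurable lborel" "measure lborel (passed \<gamma> b) \<le> \<epsilon>"
proof -
  have "continuous_on UNIV \<gamma>"
    using graph_curves_lipschitz[OF assms unit] L lipschitz_on_continuous_on by fastforce
  then have "open (\<gamma> -` G)"
    using openG by (simp add: open_vimage)
  then have m: "passed \<gamma> b \<in> sets borel" "{s. \<gamma> s \<in> G} \<in> sets borel"
  proof -
    show "{s. \<gamma> s \<in> G} \<in> sets borel"
      using \<open>open (\<gamma> -` G)\<close> by (simp add: vimage_def)
    then have "{s. \<gamma> s \<in> G} \<inter> {..b} \<in> sets borel"
      by auto
    also have "{s. \<gamma> s \<in> G} \<inter> {..b} = passed \<gamma> b"
      by (auto simp: passed_def)
    finally show "passed \<gamma> b \<in> sets borel" .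
  qed
  have "emeasure lborel (passed \<gamma> b) \<le> emeasure lborel {s. \<gamma> s \<in> G}"
    using m by (intro emeasure_mono) (auto simp: passed_def)
  also have "\<dots> \<le> ennreal \<epsilon>"
    by (rule thin[OF assms])
  finally have le: "emeasure lborel (passed \<gamma> b) \<le> ennreal \<epsilon>" .
  then show "passed \<gamma> b \<in> fmeasurable lborel"
    using m by (intro fmeasurableI) (auto simp: le_less_trans)
  show "measure lborel (passed \<gamma> b) \<le> \<epsilon>"
    using le \<epsilon> by (simp add: measure_def enn2real_leI)
qed

text \<open>Continuing in an admissible direction keeps all the time already spent in
  \<open>G\<close>, and gains \<tau> if the new segment lies in \<open>G\<close>. The lower slope
  bound along \<open>e\<close> and the bound across \<open>e\<close> come from such
  continuations.\<close>

lemma extend_passed: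
  assumes \<gamma>: "\<gamma> \<in> graph_curves e L" and d: "d \<bullet> e = 1" "norm (d - e) \<le> L" and \<tau>: "0 \<le> \<tau>"
  obtains \<gamma>' where "\<gamma>' \<in> graph_curves e L" "\<gamma>' (b + \<tau>) = \<gamma> b + \<tau> *\<^sub>R d"
    "measure lborel (passed \<gamma> b) \<le> measure lborel (passed \<gamma>' (b + \<tau>))"
    "(\<And>s. 0 \<le> s \<Longrightarrow> s \<le> \<tau> \<Longrightarrow> \<gamma> b + s *\<^sub>R d \<in> G) \<Longrightarrow>
       measure lborel (passed \<gamma> b) + \<tau> \<le> measure lborel (passed \<gamma>' (b + \<tau>))"
proof -
  define \<gamma>' where "\<gamma>' s = (if s \<le> b then \<gamma> s else \<gamma> b + (s - b) *\<^sub>R d)" for s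
  have \<gamma>': "\<gamma>' \<in> graph_curves e L"
    unfolding \<gamma>'_def by (rule graph_curves_extend[OF \<gamma> d])
  note fm = passed_fmeasurable(1)[OF \<gamma>] passed_fmeasurable(1)[OF \<gamma>']
  have sub: "passed \<gamma> b \<subseteq> passed \<gamma>' (b + \<tau>)"
    using \<tau> by (auto simp: passed_def \<gamma>'_def)
  have gain: "measure lborel (passed \<gamma> b) + \<tau> \<le> measure lborel (passed \<gamma>' (b + \<tau>))"
    if seg: "\<And>s. 0 \<le> s \<Longrightarrow> s \<le> \<tau> \<Longrightarrow> \<gamma> b + s *\<^sub>R d \<in> G"
  proof -
    have "{b<..b + \<tau>} \<subseteq> passed \<gamma>' (b + \<tau>)"
      using seg by (auto simp: passed_def \<gamma>'_def)
    with sub have "measure lborel (passed \<gamma> b \<union> {b<..b + \<tau>}) \<le> measure lborel (passed \<gamma>' (b + \<tau>))"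
      using fm[THEN fmeasurableD] by (intro measure_mono_fmeasurable fm) auto
    moreover have "measure lborel (passed \<gamma> b \<union> {b<..b + \<tau>}) = measure lborel (passed \<gamma> b) + \<tau>"
    proof -
      have "AE s in lborel. s \<notin> passed \<gamma> b \<or> s \<notin> {b<..b + \<tau>}"
        by (auto simp: passed_def)
      then have "measure lborel (passed \<gamma> b \<union> {b<..b + \<tau>}) = measure lborel (passed \<gamma> b) + measure lborel {b<..b + \<tau>}"
        using fm(1)[of b] \<tau> by (intro measure_Un_AE) (auto simp: fmeasurable_def)
      then show ?thesis
        using \<tau> by simp
    qed
    ultimately show ?thesis by simp
  qed
  show ?thesis
    by (rule that[OF \<gamma>' _ _ gain])
      (use \<tau> sub fm in \<open>auto simp: \<gamma>'_def intro: measure_mono_fmeasurable\<close>)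
qed

text \<open>
  The curve may end above \<open>x\<close> in direction \<open>e\<close>, at the price of the extra height; this penalty
  is what keeps the slope of the potential in direction \<open>e\<close> below 1.
\<close>

definition ends_above :: "'a \<Rightarrow> ((real \<Rightarrow> 'a) \<times> real) set" where
  "ends_above x = {(\<gamma>, b). \<gamma> \<in> graph_curves e L \<and> x \<bullet> e \<le> b \<and> \<gamma> b = x + (b - x \<bullet> e) *\<^sub>R e}"

definition potential :: "'a \<Rightarrow> real" where
  "potential x = (SUP (\<gamma>, b)\<in>ends_above x. measure lborel (passed \<gamma> b) - (b - x \<bullet> e))"

lemma line_ends_above: "(\<lambda>s. x + (s - x \<bullet> e) *\<^sub>R e, x \<bullet> e) \<in> ends_above x"
  using graph_curves_line[OF unit, of L x "x \<bullet> e"] L by (auto simp: ends_above_def)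

lemma potential_ge:
  assumes "(\<gamma>, b) \<in> ends_above x"
  shows "measure lborel (passed \<gamma> b) - (b - x \<bullet> e) \<le> potential x"
proof -
  have "bdd_above ((\<lambda>(\<gamma>, b). measure lborel (passed \<gamma> b) - (b - x \<bullet> e)) ` ends_above x)"
  proof (rule bdd_aboveI2[where M = \<epsilon>], clarify)
    fix \<gamma> b assume "(\<gamma>, b) \<in> ends_above x"
    then show "measure lborel (passed \<gamma> b) - (b - x \<bullet> e) \<le> \<epsilon>"
      using passed_fmeasurable(2)[of \<gamma> b] by (auto simp: ends_above_def)
  qed
  from cSUP_upper[OF assms this] show ?thesis
    by (simp add: potential_def)
qed

lemma potential_le:
  assumes "\<And>\<gamma> b. (\<gamma>, b) \<in> ends_above x \<Longrightarrow> measure lborel (passed \<gamma> b) - (b - x \<bullet> e) \<le> c"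
  shows "potential x \<le> c"
  unfolding potential_def using line_ends_above[of x] assms by (intro cSUP_least) auto

lemma potential_bounds: "0 \<le> potential x" "potential x \<le> \<epsilon>"
proof -
  show "0 \<le> potential x"
    using potential_ge[OF line_ends_above[of x]] by (simp add: order_trans[OF measure_nonneg])
  show "potential x \<le> \<epsilon>"
  proof (rule potential_le)
    fix \<gamma> b assume "(\<gamma>, b) \<in> ends_above x"
    then show "measure lborel (passed \<gamma> b) - (b - x \<bullet> e) \<le> \<epsilon>"
      using passed_fmeasurable(2)[of \<gamma> b] by (auto simp: ends_above_def)
  qed
qed

text \<open>A curve that ends above the higher point also ends above \<open>x\<close>, where the
  same end costs \<open>t\<close> more.\<close>

lemma potential_along_upper:
  assumes "0 \<le> t"
  shows "potential (x + t *\<^sub>R e) \<le> potential x + t"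
proof (rule potential_le)
  fix \<gamma> b assume "(\<gamma>, b) \<in> ends_above (x + t *\<^sub>R e)"
  then have "(\<gamma>, b) \<in> ends_above x"
    using assms by (auto simp: ends_above_def inner_add_left ee algebra_simps)
  from potential_ge[OF this]
  show "measure lborel (passed \<gamma> b) - (b - (x + t *\<^sub>R e) \<bullet> e) \<le> potential x + t"
    by (simp add: inner_add_left ee)
qed

text \<open>A curve ending above \<open>x\<close> either reaches the height of the upper point
  already, and then its penalty there is smaller by \<open>t\<close>, or it is continued along
  \<open>e\<close> to the upper point, which removes the penalty.\<close>

lemma potential_along_lower:
  assumes t: "0 \<le> t"
  shows "potential x \<le> potential (x + t *\<^sub>R e)"
    and "(\<And>s. 0 \<le> s \<Longrightarrow> s \<le> t \<Longrightarrow> x + s *\<^sub>R e \<in> G) \<Longrightarrow> potential x \<le> potential (x + t *\<^sub>R e) - t"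
proof -
  let ?y = "x + t *\<^sub>R e"
  have *: "measure lborel (passed \<gamma> b) - (b - x \<bullet> e) \<le> potential ?y \<and>
     ((\<forall>s. 0 \<le> s \<and> s \<le> t \<longrightarrow> x + s *\<^sub>R e \<in> G) \<longrightarrow> measure lborel (passed \<gamma> b) - (b - x \<bullet> e) \<le> potential ?y - t)"
    if A: "(\<gamma>, b) \<in> ends_above x" for \<gamma> b
  proof (cases "x \<bullet> e + t \<le> b")
    case True
    then have "(\<gamma>, b) \<in> ends_above ?y"
      using A by (auto simp: ends_above_def inner_add_left ee algebra_simps)
    from potential_ge[OF this] show ?thesis
      using t by (simp add: inner_add_left ee)
  next
    case False
    \<comment> \<open>The missing height. As \<open>\<tau> + (b - x \<bullet> e) = t\<close>, the
      time gained in \<open>G\<close> and the penalty saved add up to exactly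
      \<open>t\<close>.\<close>
    define \<tau> where "\<tau> = x \<bullet> e + t - b"
    have \<gamma>: "\<gamma> \<in> graph_curves e L" "x \<bullet> e \<le> b" "\<gamma> b = x + (b - x \<bullet> e) *\<^sub>R e"
      using A by (auto simp: ends_above_def)
    obtain \<gamma>' where \<gamma>': "\<gamma>' \<in> graph_curves e L" "\<gamma>' (b + \<tau>) = \<gamma> b + \<tau> *\<^sub>R e"
      "measure lborel (passed \<gamma> b) \<le> measure lborel (passed \<gamma>' (b + \<tau>))"
      "(\<And>s. 0 \<le> s \<Longrightarrow> s \<le> \<tau> \<Longrightarrow> \<gamma> b + s *\<^sub>R e \<in> G) \<Longrightarrow>
         measure lborel (passed \<gamma> b) + \<tau> \<le> measure lborel (passed \<gamma>' (b + \<tau>))"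
      using extend_passed[OF \<gamma>(1) ee, of \<tau> b] False L by (auto simp: \<tau>_def)
    have "(\<gamma>', b + \<tau>) \<in> ends_above ?y"
      using \<gamma>'(1,2) \<gamma>(3) by (auto simp: ends_above_def inner_add_left ee \<tau>_def algebra_simps)
    from potential_ge[OF this]
    have ge: "measure lborel (passed \<gamma>' (b + \<tau>)) \<le> potential ?y"
      by (simp add: inner_add_left ee \<tau>_def)
    moreover have "measure lborel (passed \<gamma> b) + \<tau> \<le> potential ?y"
      if "\<forall>s. 0 \<le> s \<and> s \<le> t \<longrightarrow> x + s *\<^sub>R e \<in> G"
    proof (rule order_trans[OF \<gamma>'(4) ge])
      fix s assume "0 \<le> s" "s \<le> \<tau>"
      then have "x + (b - x \<bullet> e + s) *\<^sub>R e \<in> G"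
        using that \<gamma>(2) by (auto simp: \<tau>_def)
      then show "\<gamma> b + s *\<^sub>R e \<in> G"
        by (simp add: \<gamma>(3) algebra_simps)
    qed
    ultimately show ?thesis
      using \<gamma>'(3) \<gamma>(2) by (auto simp: \<tau>_def)
  qed
  show "potential x \<le> potential ?y"
    by (rule potential_le) (use * in blast)
  show "potential x \<le> potential ?y - t" if "\<And>s. 0 \<le> s \<Longrightarrow> s \<le> t \<Longrightarrow> x + s *\<^sub>R e \<in> G"
    by (rule potential_le) (use * that in blast)
qed

text \<open>A curve above \<open>x\<close> is led to a point above \<open>x + v\<close> by moving
  sideways at the full slope \<open>L\<close>. The height \<open>norm v / L\<close> gained meanwhile
  is the only loss, as it enters the penalty.\<close>

lemma potential_across:
  assumes v: "v \<bullet> e = 0"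
  shows "\<bar>potential (x + v) - potential x\<bar> \<le> norm v / L"
proof -
  have *: "potential x \<le> potential (x + v) + norm v / L" if v: "v \<bullet> e = 0" for x v
  proof (cases "v = 0")
    case False
    define \<tau> where "\<tau> = norm v / L"
    have \<tau>: "\<tau> > 0"
      using False L by (simp add: \<tau>_def)
    define d where "d = e + (1 / \<tau>) *\<^sub>R v"
    have d: "d \<bullet> e = 1" "norm (d - e) \<le> L" "\<tau> *\<^sub>R d = \<tau> *\<^sub>R e + v"
      using \<tau> v False L by (auto simp: d_def inner_add_left ee \<tau>_def scaleR_add_right)
    show ?thesis
    proof (rule potential_le)
      fix \<gamma> b assume "(\<gamma>, b) \<in> ends_above x"
      then have \<gamma>: "\<gamma> \<in> graph_curves e L" "x \<bullet> e \<le> b" "\<gamma> b = x + (b - x \<bullet> e) *\<^sub>R e"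
        by (auto simp: ends_above_def)
      obtain \<gamma>' where \<gamma>': "\<gamma>' \<in> graph_curves e L" "\<gamma>' (b + \<tau>) = \<gamma> b + \<tau> *\<^sub>R d"
        "measure lborel (passed \<gamma> b) \<le> measure lborel (passed \<gamma>' (b + \<tau>))"
        using extend_passed[OF \<gamma>(1) d(1,2), of \<tau> b] \<tau> by auto
      have "(\<gamma>', b + \<tau>) \<in> ends_above (x + v)"
        using \<gamma>' \<gamma> \<tau> d(3) v by (auto simp: ends_above_def inner_add_left algebra_simps)
      from potential_ge[OF this] \<gamma>'(3)
      show "measure lborel (passed \<gamma> b) - (b - x \<bullet> e) \<le> potential (x + v) + norm v / L"
        using v by (simp add: inner_add_left \<tau>_def)
    qed
  qed simp
  show ?thesis
    using *[OF v, of x] *[of "-v" "x + v"] v by simp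
qed

lemma potential_continuous: "continuous_on UNIV potential"
proof -
  have "(1 + 2 / L)-lipschitz_on UNIV potential"
  proof (rule lipschitz_onI)
    fix x y
    define v where "v = (y - x) - ((y - x) \<bullet> e) *\<^sub>R e"
    define t where "t = (y - x) \<bullet> e"
    have v: "v \<bullet> e = 0" and y: "y = (x + v) + t *\<^sub>R e"
      by (auto simp: v_def t_def inner_diff_left ee)
    have t: "\<bar>t\<bar> \<le> norm (y - x)"
      using Cauchy_Schwarz_ineq2[of "y - x" e] unit by (simp add: t_def)
    have "norm v \<le> norm (y - x) + norm (t *\<^sub>R e)"
      unfolding v_def t_def by (rule norm_triangle_ineq4)
    then have nv: "norm v / L \<le> 2 / L * norm (y - x)"
      using t unit L by (simp add: field_simps)
    have "\<bar>potential y - potential (x + v)\<bar> \<le> \<bar>t\<bar>"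
    proof (cases "0 \<le> t")
      case True
      then show ?thesis
        using potential_along_upper[OF True, of "x + v"] potential_along_lower(1)[OF True, of "x + v"] y by simp
    next
      case False
      then have "0 \<le> - t" "x + v = y + (- t) *\<^sub>R e"
        using y by auto
      then show ?thesis
        using potential_along_upper[of "-t" y] potential_along_lower(1)[of "-t" y] by simp
    qed
    with potential_across[OF v, of x] t nv
    have "\<bar>potential y - potential x\<bar> \<le> norm (y - x) + 2 / L * norm (y - x)"
      by linarith
    then show "dist (potential x) (potential y) \<le> (1 + 2 / L) * dist x y"
      by (simp add: dist_real_def dist_norm norm_minus_commute abs_minus_commute algebra_simps)
  qed (use L in simp)
  then show ?thesis
    by (rule lipschitz_on_continuous_on)
qed

end

text \<open>\<open>G\<close> comes from the infimum that defines the width. Graph curves of this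
  slope compete in the supremum for \<open>G\<close>, and projection to the axis bounds the time in
  \<open>G\<close> by the Hausdorff measure of the trace.\<close>

lemma width_zero_imp_thin:
  assumes \<alpha>: "0 < \<alpha>" "\<alpha> < 1" and e: "norm e = 1" and \<epsilon>: "0 < \<epsilon>" and w: "width e \<alpha> E = 0"
  obtains G where "E \<subseteq> G" "thin_open_set G e (sqrt (1 - \<alpha>\<^sup>2) / \<alpha>) \<epsilon>"
proof -
  have "width e \<alpha> E < ennreal \<epsilon>"
    using w \<epsilon> by simp
  then obtain G where G: "open G" "E \<subseteq> G" "width_open e \<alpha> G < ennreal \<epsilon>"
    unfolding width_def by (auto simp: INF_less_iff)
  have "emeasure lborel {s. \<gamma> s \<in> G} \<le> ennreal \<epsilon>" if \<gamma>: "\<gamma> \<in> graph_curves e (sqrt (1 - \<alpha>\<^sup>2) / \<alpha>)" for \<gamma>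
  proof -
    have "continuous_on UNIV \<gamma>"
      using graph_curves_lipschitz[OF \<gamma> e] \<alpha> lipschitz_on_continuous_on
      by (fastforce simp: power_le_one)
    then have "open (\<gamma> -` G)"
      using G(1) by (simp add: open_vimage)
    then have S: "{s. \<gamma> s \<in> G} \<in> sets borel"
      by (simp add: vimage_def)

    define c where "c = \<gamma> 0 \<bullet> e"
    have h: "\<gamma> s \<bullet> e = s + c" for s
      using graph_curvesD(1)[OF \<gamma>, of 0 s] graph_curvesD(1)[OF \<gamma>, of s 0]
      by (cases "0 \<le> s") (auto simp: c_def inner_diff_left)
    have "emeasure lborel {s. \<gamma> s \<in> G} \<le> hausdorff1 (G \<inter> range \<gamma>)"
    proof (rule emeasure_projection_le_hausdorff1[OF e S, of c])
      show "{s. \<gamma> s \<in> G} \<subseteq> (\<lambda>a. a \<bullet> e - c) ` (G \<inter> range \<gamma>)"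
      proof
        fix s assume "s \<in> {s. \<gamma> s \<in> G}"
        then show "s \<in> (\<lambda>a. a \<bullet> e - c) ` (G \<inter> range \<gamma>)"
          by (intro image_eqI[of _ _ "\<gamma> s"]) (auto simp: h)
      qed
    qed
    also have "\<dots> \<le> width_open e \<alpha> G"
      unfolding width_open_def
      using graph_curves_subset_cone_curves[OF \<alpha> e] \<gamma> by (intro SUP_upper) auto
    finally show ?thesis
      using G(3) by (simp add: order.strict_implies_order order.trans)
  qed
  then have "thin_open_set G e (sqrt (1 - \<alpha>\<^sup>2) / \<alpha>) \<epsilon>"
    using G e \<epsilon> \<alpha> by unfold_locales (auto simp: power_less_one_iff)
  then show thesis
    using that G(2) by blast
qed

section \<open>Local perturbations\<close>

lemma bump:
  fixes K :: "'a::euclidean_space set"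
  assumes K: "K \<noteq> {}" and \<delta>: "0 < \<delta>"
  obtains \<phi> q where "has_gradient \<phi> q" "\<And>x. 0 \<le> \<phi> x" "\<And>x. \<phi> x \<le> 1" "\<And>x. x \<in> K \<Longrightarrow> \<phi> x = 1"
    "\<And>x. \<delta> \<le> infdist x K \<Longrightarrow> \<phi> x = 0 \<and> q x = 0" "\<And>x. norm (q x) \<le> 3 / \<delta>"
proof -
  \<comment> \<open>This is 1 up to distance \<open>\<delta> / 3\<close> from \<open>K\<close> and 0
    from \<open>2 / 3 * \<delta>\<close> on. Averaging over radius \<open>\<delta> / 4\<close>
    therefore keeps the value 1 on \<open>K\<close> and gives 0 from distance
    \<open>11 / 12 * \<delta>\<close> on.\<close>
  define \<psi> where "\<psi> x = max 0 (min 1 (2 - 3 / \<delta> * infdist x K))" for x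
  have "continuous_on UNIV \<psi>"
    unfolding \<psi>_def by (intro continuous_intros)
  then obtain \<phi> q where \<phi>: "has_gradient \<phi> q" "averages (\<delta> / 4) \<psi> \<phi>"
    using \<delta> by (auto elim: smoothing[of \<psi> "\<delta> / 4"])
  have inf: "\<bar>infdist (x + w) K - infdist x K\<bar> \<le> norm w" for x w
    using infdist_triangle[of "x + w" K x] infdist_triangle[of x K "x + w"]
    by (simp add: dist_norm abs_le_iff)
  have lip: "\<psi> (y + w) - \<psi> (x + w) \<le> 3 / \<delta> * norm (y - x)" for x y w
  proof -
    have "\<bar>infdist (y + w) K - infdist (x + w) K\<bar> \<le> norm (y - x)"
      using inf[of "x + w" "y - x"] by (simp add: algebra_simps)
    then have "infdist (x + w) K \<le> infdist (y + w) K + norm (y - x)"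
      by linarith
    then have "3 / \<delta> * infdist (x + w) K \<le> 3 / \<delta> * (infdist (y + w) K + norm (y - x))"
      using \<delta> by (intro mult_left_mono) auto
    moreover have "0 \<le> 3 / \<delta> * norm (y - x)"
      using \<delta> by simp
    ultimately show ?thesis
      unfolding \<psi>_def distrib_left by linarith
  qed
  have zero: "\<phi> x = 0" if "11 / 12 * \<delta> \<le> infdist x K" for x
  proof -
    have "\<psi> (x + w) = 0" if "norm w \<le> \<delta> / 4" for w
    proof -
      have "2 / 3 * \<delta> \<le> infdist (x + w) K"
        using inf[of x w] \<open>11 / 12 * \<delta> \<le> infdist x K\<close> that by linarith
      then show ?thesis
        using \<delta> by (simp add: \<psi>_def field_simps)
    qed
    then show ?thesis
      using averages_value[OF \<phi>(2), where x = x and d = 0] by force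
  qed
  show thesis
  proof (rule that[OF \<phi>(1)])
    show "0 \<le> \<phi> x" "\<phi> x \<le> 1" for x
      by (rule averages_value[OF \<phi>(2)]; simp add: \<psi>_def)+
    show "\<phi> x = 1" if "x \<in> K" for x
    proof -
      have "\<psi> (x + w) = 1" if "norm w \<le> \<delta> / 4" for w
      proof -
        have "infdist (x + w) K \<le> \<delta> / 3"
          using inf[of x w] \<open>x \<in> K\<close> that \<delta> by simp
        then show ?thesis
          using \<delta> by (simp add: \<psi>_def field_simps)
      qed
      then show ?thesis
        using averages_value[OF \<phi>(2), where x = x and d = 1] by force
    qed
    show "\<phi> x = 0 \<and> q x = 0" if x: "\<delta> \<le> infdist x K" for x
    proof
      show 0: "\<phi> x = 0"
        using x \<delta> by (intro zero) auto
      have "v \<bullet> q x = 0" for v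
      proof -
        \<comment> \<open>Moves shorter than \<open>\<delta> / 12\<close> from a point at distance
          \<delta> stay where \<phi> vanishes, so the gradient vanishes as well, even at distance
          exactly \<delta>.\<close>
        define t0 where "t0 = \<delta> / (12 * (norm v + 1))"
        have "\<phi> (x + t *\<^sub>R v) = 0" if t: "0 < t" "t < t0" for t
        proof (rule zero)
          have "t * norm v \<le> t0 * (norm v + 1)"
            using t by (intro mult_mono) auto
          also have "\<dots> = \<delta> / 12"
            by (simp add: t0_def field_simps add_nonneg_eq_0_iff)
          finally show "11 / 12 * \<delta> \<le> infdist (x + t *\<^sub>R v) K"
            using inf[of x "t *\<^sub>R v"] x t by auto
        qed
        moreover have "0 < t0"
          using \<delta> by (simp add: t0_def add_nonneg_pos)
        ultimately show ?thesis
          using inner_gradient_bounds[OF \<phi>(1), of t0 0 x v 0] 0 by force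
      qed
      then show "q x = 0"
        using inner_eq_zero_iff by blast
    qed
    show "norm (q x) \<le> 3 / \<delta>" for x
    proof -
      have "q x \<bullet> q x \<le> 3 / \<delta> * norm (q x)"
      proof (rule inner_gradient_bounds(2)[OF \<phi>(1), of 1 "- (3 / \<delta> * norm (q x))"])
        fix t :: real assume t: "0 < t"
        have n: "3 / \<delta> * norm (x + t *\<^sub>R q x - x) = 3 / \<delta> * norm (q x) * t"
          "3 / \<delta> * norm (x - (x + t *\<^sub>R q x)) = 3 / \<delta> * norm (q x) * t"
          using t by auto
        show "\<phi> (x + t *\<^sub>R q x) - \<phi> x \<le> 3 / \<delta> * norm (q x) * t"
          unfolding n(1)[symmetric] by (rule averages_diff(1)[OF \<phi>(2) lip])
        have "\<phi> x - \<phi> (x + t *\<^sub>R q x) \<le> 3 / \<delta> * norm (q x) * t"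
          unfolding n(2)[symmetric] by (rule averages_diff(1)[OF \<phi>(2) lip])
        then show "- (3 / \<delta> * norm (q x)) * t \<le> \<phi> (x + t *\<^sub>R q x) - \<phi> x"
          by simp
      qed simp
      then show ?thesis
        unfolding dot_square_norm power2_eq_square using \<delta>
        by (cases "q x = 0") (auto simp del: times_divide_eq_left)
    qed
  qed
qed

lemma width_mono: "E \<subseteq> F \<Longrightarrow> width e \<alpha> E \<le> width e \<alpha> F"
  unfolding width_def by (rule INF_superset_mono) auto

lemma smooth_potential:
  fixes K :: "'a::euclidean_space set"
  assumes \<alpha>: "0 < \<alpha>" "\<alpha> < 1" and e: "norm e = 1" and \<epsilon>: "0 < \<epsilon>"
    and K: "compact K" and w: "width e \<alpha> K = 0"
  obtains \<omega> q where "has_gradient \<omega> q" "\<And>x. 0 \<le> \<omega> x" "\<And>x. \<omega> x \<le> \<epsilon>"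
    "\<And>x. 0 \<le> e \<bullet> q x" "\<And>x. e \<bullet> q x \<le> 1" "\<And>x. x \<in> K \<Longrightarrow> e \<bullet> q x = 1"
    "\<And>x. norm (q x - (e \<bullet> q x) *\<^sub>R e) \<le> \<alpha> / sqrt (1 - \<alpha>\<^sup>2)"
proof -
  obtain G where G: "K \<subseteq> G" "thin_open_set G e (sqrt (1 - \<alpha>\<^sup>2) / \<alpha>) \<epsilon>"
    using width_zero_imp_thin[OF \<alpha> e \<epsilon> w] .
  interpret thin_open_set G e "sqrt (1 - \<alpha>\<^sup>2) / \<alpha>" \<epsilon>
    by (rule G(2))
  obtain d where d: "0 < d" "(\<Union>x\<in>K. ball x d) \<subseteq> G"
    using compact_subset_open_imp_ball_epsilon_subset[OF K openG G(1)] by blast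
  \<comment> \<open>Half of \<open>d\<close> is spent on the average and half on the increment along
    \<open>e\<close>, so that the segments considered at points of \<open>K\<close> stay in
    \<open>G\<close>.\<close>
  obtain \<omega> q where \<omega>: "has_gradient \<omega> q" "averages (d / 2) potential \<omega>"
    using smoothing[OF potential_continuous, of "d / 2"] d(1) by auto
  have incr: "0 * t \<le> \<omega> (x + t *\<^sub>R e) - \<omega> x" "\<omega> (x + t *\<^sub>R e) - \<omega> x \<le> 1 * t" if t: "0 < t" for t x
  proof -
    show "0 * t \<le> \<omega> (x + t *\<^sub>R e) - \<omega> x"
    proof (rule averages_diff[OF \<omega>(2)])
      fix w
      show "0 * t \<le> potential (x + t *\<^sub>R e + w) - potential (x + w)"
        using potential_along_lower(1)[of t "x + w"] t by (simp add: add_ac)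
    qed
    show "\<omega> (x + t *\<^sub>R e) - \<omega> x \<le> 1 * t"
    proof (rule averages_diff[OF \<omega>(2)])
      fix w
      show "potential (x + t *\<^sub>R e + w) - potential (x + w) \<le> 1 * t"
        using potential_along_upper[of t "x + w"] t by (simp add: add_ac)
    qed
  qed
  have low: "0 \<le> e \<bullet> q x" and up: "e \<bullet> q x \<le> 1" for x
    by (rule inner_gradient_bounds[OF \<omega>(1) zero_less_one, of 0 x e 1]; use incr in blast)+
  show thesis
  proof (rule that[OF \<omega>(1) _ _ low up])
    show "0 \<le> \<omega> x" "\<omega> x \<le> \<epsilon>" for x
      by (rule averages_value[OF \<omega>(2)]; simp add: potential_bounds)+
    show "e \<bullet> q x = 1" if x: "x \<in> K" for x
    proof (rule antisym[OF up])
      show "1 \<le> e \<bullet> q x"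
      proof (rule inner_gradient_bounds(1)[OF \<omega>(1), of "d / 2" 1 x e 1])
        fix t assume t: "0 < t" "t < d / 2"
        show "1 * t \<le> \<omega> (x + t *\<^sub>R e) - \<omega> x"
        proof (rule averages_diff[OF \<omega>(2)])
          fix w :: 'a assume w: "norm w \<le> d / 2"
          have "x + w + s *\<^sub>R e \<in> G" if "0 \<le> s" "s \<le> t" for s
          proof -
            have "norm (w + s *\<^sub>R e) \<le> norm w + norm (s *\<^sub>R e)"
              by (rule norm_triangle_ineq)
            also have "\<dots> < d"
              using w t that unit by simp
            finally have "x + w + s *\<^sub>R e \<in> ball x d"
              unfolding mem_ball dist_commute[of x] by (simp add: dist_norm add.assoc)
            then show ?thesis
              using d(2) x by blast
          qed
          then have "potential (x + w) \<le> potential (x + w + t *\<^sub>R e) - t"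
            using t by (intro potential_along_lower(2)) auto
          then show "1 * t \<le> potential (x + t *\<^sub>R e + w) - potential (x + w)"
            by (simp add: add_ac)
        qed
      qed (use d incr in auto)
    qed
    show "norm (q x - (e \<bullet> q x) *\<^sub>R e) \<le> \<alpha> / sqrt (1 - \<alpha>\<^sup>2)" for x
    proof -
      \<comment> \<open>The part of the gradient across \<open>e\<close> is tested against itself:
        \<open>v \<bullet> q x\<close> is its squared norm, whereas the slope of the potential in
        direction \<open>v\<close> is at most \<open>\<kappa> * norm v\<close>.\<close>
      define v where "v = q x - (e \<bullet> q x) *\<^sub>R e"
      define \<kappa> where "\<kappa> = \<alpha> / sqrt (1 - \<alpha>\<^sup>2)"
      have v: "v \<bullet> e = 0"
        by (simp add: v_def inner_diff_left ee inner_commute[of e "q x"])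
      have across: "\<bar>potential (x + t *\<^sub>R v + w) - potential (x + w)\<bar> \<le> \<kappa> * norm v * t" if "0 < t" for t w
        using potential_across[of "t *\<^sub>R v" "x + w"] v that by (simp add: add_ac \<kappa>_def mult_ac)
      have "v \<bullet> q x \<le> \<kappa> * norm v"
      proof (rule inner_gradient_bounds(2)[OF \<omega>(1), of 1 "- (\<kappa> * norm v)"])
        fix t :: real assume t: "0 < t"
        show "- (\<kappa> * norm v) * t \<le> \<omega> (x + t *\<^sub>R v) - \<omega> x"
        proof (rule averages_diff(2)[OF \<omega>(2)])
          show "- (\<kappa> * norm v) * t \<le> potential (x + t *\<^sub>R v + w) - potential (x + w)" for w
            using across[OF t, of w] unfolding mult_minus_left by linarith
        qed
        show "\<omega> (x + t *\<^sub>R v) - \<omega> x \<le> \<kappa> * norm v * t"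
        proof (rule averages_diff(1)[OF \<omega>(2)])
          show "potential (x + t *\<^sub>R v + w) - potential (x + w) \<le> \<kappa> * norm v * t" for w
            using across[OF t, of w] by linarith
        qed
      qed simp
      moreover have "v \<bullet> q x = v \<bullet> v"
        using v by (simp add: v_def inner_diff_right)
      ultimately have "norm v * norm v \<le> \<kappa> * norm v"
        by (simp add: dot_square_norm power2_eq_square)
      moreover have "0 \<le> \<kappa>"
        using \<alpha> by (simp add: \<kappa>_def power_le_one)
      ultimately have "norm v \<le> \<kappa>"
        by (cases "v = 0") auto
      then show ?thesis
        by (simp add: v_def \<kappa>_def)
    qed
  qed
qed

text \<open>The perturbation is a cutoff times a potential. In the product rule the term with the
  gradient of the cutoff is small, because the potential is chosen after the cutoff and may be as
  small as its gradient bound \<open>3 / \<delta>\<close> requires.\<close>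

proposition local_perturbation:
  fixes K :: "'a::euclidean_space set"
  assumes \<alpha>: "0 < \<alpha>" "\<alpha> < 1" and e: "norm e = 1" and \<epsilon>: "0 < \<epsilon>" and \<delta>: "0 < \<delta>"
    and K: "compact K" "K \<noteq> {}" and w: "width e \<alpha> K = 0"
  obtains g q where "has_gradient g q" "\<And>x. \<bar>g x\<bar> \<le> \<epsilon>"
    "\<And>x. \<delta> \<le> infdist x K \<Longrightarrow> g x = 0 \<and> q x = 0"
    "\<And>x. \<exists>s. 0 \<le> s \<and> s \<le> 1 \<and> norm (q x - s *\<^sub>R e) \<le> \<alpha> / sqrt (1 - \<alpha>\<^sup>2) + \<epsilon>"
    "\<And>x. x \<in> K \<Longrightarrow> norm (q x - e) \<le> \<alpha> / sqrt (1 - \<alpha>\<^sup>2) + \<epsilon>"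
proof -
  obtain \<phi> p where \<phi>: "has_gradient \<phi> p" "\<And>x. 0 \<le> \<phi> x" "\<And>x. \<phi> x \<le> 1" "\<And>x. x \<in> K \<Longrightarrow> \<phi> x = 1"
    "\<And>x. \<delta> \<le> infdist x K \<Longrightarrow> \<phi> x = 0 \<and> p x = 0" "\<And>x. norm (p x) \<le> 3 / \<delta>"
    using bump[OF K(2) \<delta>] by blast
  define \<epsilon>' where "\<epsilon>' = min \<epsilon> (\<epsilon> * \<delta> / 3)"
  have \<epsilon>': "0 < \<epsilon>'" "\<epsilon>' \<le> \<epsilon>" "\<epsilon>' * (3 / \<delta>) \<le> \<epsilon>"
    using \<epsilon> \<delta> by (auto simp: \<epsilon>'_def min_def field_simps)
  obtain \<omega> q where \<omega>: "has_gradient \<omega> q" "\<And>x. 0 \<le> \<omega> x" "\<And>x. \<omega> x \<le> \<epsilon>'"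
    "\<And>x. 0 \<le> e \<bullet> q x" "\<And>x. e \<bullet> q x \<le> 1" "\<And>x. x \<in> K \<Longrightarrow> e \<bullet> q x = 1"
    "\<And>x. norm (q x - (e \<bullet> q x) *\<^sub>R e) \<le> \<alpha> / sqrt (1 - \<alpha>\<^sup>2)"
    using smooth_potential[OF \<alpha> e \<epsilon>'(1) K(1) w] by blast
  let ?r = "\<lambda>x. \<phi> x *\<^sub>R q x + \<omega> x *\<^sub>R p x"
  have main: "norm (?r x - (\<phi> x * (e \<bullet> q x)) *\<^sub>R e) \<le> \<alpha> / sqrt (1 - \<alpha>\<^sup>2) + \<epsilon>" for x
  proof -
    have "?r x - (\<phi> x * (e \<bullet> q x)) *\<^sub>R e = \<phi> x *\<^sub>R (q x - (e \<bullet> q x) *\<^sub>R e) + \<omega> x *\<^sub>R p x"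
      by (simp add: algebra_simps)
    also have "norm \<dots> \<le> \<phi> x * norm (q x - (e \<bullet> q x) *\<^sub>R e) + \<omega> x * norm (p x)"
      using \<phi>(2)[of x] \<omega>(2)[of x] by (intro norm_triangle_le) simp
    also have "\<dots> \<le> 1 * (\<alpha> / sqrt (1 - \<alpha>\<^sup>2)) + \<epsilon>' * (3 / \<delta>)"
      using \<phi>(2,3,6)[of x] \<omega>(2,3,7)[of x] \<epsilon>'(1) by (intro add_mono mult_mono) auto
    finally show ?thesis
      using \<epsilon>'(3) by simp
  qed
  show thesis
  proof (rule that[OF has_gradient_mult[OF \<phi>(1) \<omega>(1)]])
    show "\<bar>\<phi> x * \<omega> x\<bar> \<le> \<epsilon>" for x
      using \<phi>(2,3)[of x] \<omega>(2,3)[of x] \<epsilon>'(2) mult_mono[of "\<phi> x" 1 "\<omega> x" \<epsilon>] by (simp add: abs_mult)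
    show "\<phi> x * \<omega> x = 0 \<and> ?r x = 0" if "\<delta> \<le> infdist x K" for x
      using \<phi>(5)[OF that] by simp
    show "\<exists>s. 0 \<le> s \<and> s \<le> 1 \<and> norm (?r x - s *\<^sub>R e) \<le> \<alpha> / sqrt (1 - \<alpha>\<^sup>2) + \<epsilon>" for x
      using main[of x] \<phi>(2,3)[of x] \<omega>(4,5)[of x]
      by (intro exI[of _ "\<phi> x * (e \<bullet> q x)"]) (auto intro: mult_le_one)
    show "norm (?r x - e) \<le> \<alpha> / sqrt (1 - \<alpha>\<^sup>2) + \<epsilon>" if "x \<in> K" for x
      using main[of x] \<phi>(4)[OF that] \<omega>(6)[OF that] by simp
  qed
qed

section \<open>Compact pieces on which a prescribed field is almost constant\<close>

lemma radon_measure_sets: "radon_measure M \<Longrightarrow> sets M = sets borel"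
  by (simp add: radon_measure_def)

lemma radon_measure_finite_cball: "radon_measure M \<Longrightarrow> emeasure M (cball 0 R) < \<infinity>"
  unfolding radon_measure_def using compact_cball by blast

text \<open>The main part of \<open>A - N\<close> is a Borel subset of it with the measure of
  \<open>A\<close>. Restricting \<mu> to the ball makes the measure finite, so that inner regularity
  of finite Borel measures applies to this subset.\<close>

lemma completion_inner_regular:
  fixes \<mu> :: "'a::euclidean_space measure"
  assumes \<mu>: "radon_measure \<mu>" and A: "A \<in> sets (completion \<mu>)" "A \<subseteq> cball 0 R"
    and N: "N \<in> null_sets (completion \<mu>)" and \<epsilon>: "0 < \<epsilon>"
  obtains K where "compact K" "K \<subseteq> A - N" "emeasure (completion \<mu>) (A - K) \<le> ennreal \<epsilon>"
proof -
  note sets = radon_measure_sets[OF \<mu>]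
  have AN: "A - N \<in> sets (completion \<mu>)"
    using A N by auto
  define B where "B = main_part \<mu> (A - N)"
  have B: "B \<in> sets borel" "B \<subseteq> A - N" "emeasure \<mu> B = emeasure (completion \<mu>) (A - N)"
  proof -
    show "B \<in> sets borel"
      using main_part_sets[OF AN] by (simp add: B_def sets)
    show "B \<subseteq> A - N"
      unfolding B_def using main_part_null_part_Un[OF AN] by blast
    show "emeasure \<mu> B = emeasure (completion \<mu>) (A - N)"
      using AN by (simp add: B_def)
  qed
  then have "B \<subseteq> cball 0 R"
    using A(2) by auto
  let ?\<nu> = "density \<mu> (indicator (cball 0 R))"
  have \<nu>: "emeasure ?\<nu> S = emeasure \<mu> (cball 0 R \<inter> S)" if "S \<in> sets borel" for S
    using that sets by (intro emeasure_restricted) auto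
  have fin: "emeasure \<mu> B < \<infinity>"
    using emeasure_mono[OF \<open>B \<subseteq> cball 0 R\<close>, of \<mu>] radon_measure_finite_cball[OF \<mu>, of R] sets
    by (auto intro: le_less_trans)
  have B': "cball 0 R \<inter> B = B"
    using \<open>B \<subseteq> cball 0 R\<close> by auto
  have "emeasure ?\<nu> B = (SUP K\<in>{K. K \<subseteq> B \<and> compact K}. emeasure ?\<nu> K)"
  proof (rule inner_regular)
    show "emeasure ?\<nu> (space ?\<nu>) \<noteq> \<infinity>"
      using radon_measure_finite_cball[OF \<mu>, of R] sets_eq_imp_space_eq[OF sets] \<nu>[of UNIV] by simp
  qed (use sets B in auto)
  then have "\<exists>K\<in>{K. K \<subseteq> B \<and> compact K}. emeasure ?\<nu> B < emeasure ?\<nu> K + ennreal \<epsilon>"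
    by (rule SUP_approx_ennreal[OF \<epsilon>, rotated]) (use fin \<nu>[OF B(1)] B' in auto)
  then obtain K where K: "K \<subseteq> B" "compact K" "emeasure ?\<nu> B < emeasure ?\<nu> K + ennreal \<epsilon>"
    by blast
  have Kb: "K \<in> sets borel"
    using K(2) by (simp add: borel_compact)
  have K': "cball 0 R \<inter> K = K"
    using K(1) \<open>B \<subseteq> cball 0 R\<close> by auto
  have KA: "K \<subseteq> A" "K \<in> sets \<mu>"
    using K(1) B(2) Kb sets by auto
  have Kfin: "emeasure \<mu> K < \<infinity>"
    using emeasure_mono[OF K(1), of \<mu>] fin B(1) sets by (auto intro: le_less_trans)
  have "emeasure (completion \<mu>) (A - K) = emeasure (completion \<mu>) A - emeasure \<mu> K"
    using emeasure_Diff[of "completion \<mu>" K A] KA A(1) Kfin by (simp add: sets_completionI_sets)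
  also have "emeasure (completion \<mu>) A = emeasure \<mu> B"
    using emeasure_Diff_null_set[OF N A(1)] B(3) by simp
  also have "emeasure \<mu> B - emeasure \<mu> K \<le> ennreal \<epsilon>"
    using K(3) \<nu>[OF B(1)] \<nu>[OF Kb] B' K' Kfin fin by (auto simp: ennreal_minus_le_iff less_imp_le)
  finally show thesis
    using that K B(2) by blast
qed

text \<open>The values lie in a compact ball, which has a finite net of mesh \<eta>; the preimages
  of the balls around the net points are made disjoint.\<close>

lemma finite_partition_by_value:
  fixes u :: "'b \<Rightarrow> 'a::euclidean_space"
  assumes u: "u \<in> borel_measurable M" "\<And>x. norm (u x) \<le> r" and B: "B \<in> sets M" and \<eta>: "0 < \<eta>"
  obtains n :: nat and c A where "\<And>i. A i \<in> sets M" "\<And>i. A i \<subseteq> B" "B \<subseteq> (\<Union>i<n. A i)"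
    "\<And>i j x. x \<in> A i \<Longrightarrow> x \<in> A j \<Longrightarrow> i = j" "\<And>i x. x \<in> A i \<Longrightarrow> norm (u x - c i) < \<eta>"
    "\<And>i. i < n \<Longrightarrow> norm (c i) \<le> r"
proof -
  have "\<exists>C. finite C \<and> C \<subseteq> cball (0::'a) r \<and> cball 0 r \<subseteq> (\<Union>c\<in>C. ball c \<eta>)"
    by (rule seq_compact_imp_totally_bounded[rule_format])
      (use \<eta> in \<open>auto intro: compact_imp_seq_compact\<close>)
  then obtain C where C: "finite C" "C \<subseteq> cball (0::'a) r" "cball 0 r \<subseteq> (\<Union>c\<in>C. ball c \<eta>)"
    by (elim exE conjE)
  obtain c and n :: nat where c: "C = c ` {i. i < n}"
    using C(1) finite_imp_nat_seg_image_inj_on[OF C(1)] by blast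
  define A0 where "A0 i = {x \<in> B. u x \<in> ball (c i) \<eta>}" for i
  have A0: "A0 i \<in> sets M" for i
  proof -
    have "B \<inter> (u -` ball (c i) \<eta> \<inter> space M) \<in> sets M"
      using B u(1) by (intro sets.Int measurable_sets) auto
    also have "B \<inter> (u -` ball (c i) \<eta> \<inter> space M) = A0 i"
      using sets.sets_into_space[OF B] by (auto simp: A0_def)
    finally show ?thesis .
  qed
  show thesis
  proof (rule that[of "disjointed A0" n c])
    show "disjointed A0 i \<in> sets M" for i
      using A0 sets.range_disjointed_sets[of A0 M] by blast
    show "disjointed A0 i \<subseteq> B" for i
      using disjointed_subset[of A0 i] by (auto simp: A0_def)
    show "B \<subseteq> (\<Union>i<n. disjointed A0 i)"
    proof
      fix x assume x: "x \<in> B"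
      have "u x \<in> (\<Union>c\<in>C. ball c \<eta>)"
        using u(2)[of x] C(3) by (auto simp del: mem_ball)
      then have "x \<in> (\<Union>i<n. A0 i)"
        using x by (auto simp: c A0_def)
      then show "x \<in> (\<Union>i<n. disjointed A0 i)"
        using finite_UN_disjointed_eq[of A0 n] by (simp add: lessThan_atLeast0)
    qed
    show "i = j" if "x \<in> disjointed A0 i" "x \<in> disjointed A0 j" for i j x
      using disjoint_family_disjointed[of A0] that by (auto simp: disjoint_family_on_def)
    show "norm (u x - c i) < \<eta>" if "x \<in> disjointed A0 i" for i x
      using that disjointed_subset[of A0 i] by (auto simp: A0_def dist_norm norm_minus_commute)
    show "norm (c i) \<le> r" if "i < n" for i
      using that C(2) c by auto
  qed
qed

lemma separate_finitely_many_compacts: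
  fixes K :: "nat \<Rightarrow> 'a::euclidean_space set"
  assumes "\<And>i. i < n \<Longrightarrow> compact (K i)" and "\<And>i j. i < n \<Longrightarrow> j < n \<Longrightarrow> i \<noteq> j \<Longrightarrow> K i \<inter> K j = {}"
  obtains \<delta> where "0 < \<delta>"
    "\<And>i j x y. i < n \<Longrightarrow> j < n \<Longrightarrow> i \<noteq> j \<Longrightarrow> x \<in> K i \<Longrightarrow> y \<in> K j \<Longrightarrow> \<delta> \<le> dist x y"
proof -
  have "\<exists>d>0. \<forall>x\<in>K i. \<forall>y\<in>K j. d \<le> dist x y" if "i < n" "j < n" "i \<noteq> j" for i j
    using separate_compact_closed[OF assms(1)[OF that(1)] compact_imp_closed[OF assms(1)[OF that(2)]]]
      assms(2)[OF that] by blast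
  then obtain d where d: "\<And>i j. i < n \<Longrightarrow> j < n \<Longrightarrow> i \<noteq> j \<Longrightarrow> 0 < d i j \<and> (\<forall>x\<in>K i. \<forall>y\<in>K j. d i j \<le> dist x y)"
    by metis
  let ?P = "{(i, j). i < n \<and> j < n \<and> i \<noteq> j}"
  have "finite ?P"
    by (rule finite_subset[of _ "{..<n} \<times> {..<n}"]) auto
  \<comment> \<open>The additional value 1 keeps the set nonempty when there are fewer than two
    compact sets.\<close>
  then have fin: "finite (insert 1 ((\<lambda>(i, j). d i j) ` ?P))"
    by simp
  show thesis
  proof (rule that[of "Min (insert 1 ((\<lambda>(i, j). d i j) ` ?P))"])
    show "0 < Min (insert 1 ((\<lambda>(i, j). d i j) ` ?P))"
      using fin d by (subst Min_gr_iff) auto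
    fix i j x y assume ij: "i < n" "j < n" "i \<noteq> j" and "x \<in> K i" "y \<in> K j"
    have "Min (insert 1 ((\<lambda>(i, j). d i j) ` ?P)) \<le> d i j"
      using fin ij by (intro Min_le) auto
    also have "\<dots> \<le> dist x y"
      using d[OF ij] \<open>x \<in> K i\<close> \<open>y \<in> K j\<close> by blast
    finally show "Min (insert 1 ((\<lambda>(i, j). d i j) ` ?P)) \<le> dist x y" .
  qed
qed

text \<open>A nonzero \<open>w\<close> in the intersection would satisfy \<open>\<alpha> * norm c *
  norm w \<le> w \<bullet> c = w \<bullet> (c - u)\<close>, against Cauchy-Schwarz. Thus one axis
  \<open>c\<close> serves all points whose prescribed vector \<open>u\<close> is close to
  \<open>c\<close>, and the width hypothesis is used for a single cone.\<close>

lemma dir_cone_inter_orthogonal: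
  assumes "0 \<in> T" and orth: "\<And>w. w \<in> T \<Longrightarrow> u \<bullet> w = 0" and c: "norm (u - c) < \<alpha> * norm c"
  shows "dir_cone (sgn c) \<alpha> \<inter> T = {0}"
proof -
  have c0: "c \<noteq> 0"
    using c norm_ge_zero[of "u - c"] by (intro notI) simp
  have "w = 0" if w: "w \<in> dir_cone (sgn c) \<alpha>" "w \<in> T" for w
  proof (rule ccontr)
    assume "w \<noteq> 0"
    have "\<alpha> * norm w \<le> w \<bullet> sgn c"
      using w(1) c0 by (simp add: dir_cone_def norm_sgn)
    then have "\<alpha> * norm c * norm w \<le> w \<bullet> c"
      using c0 by (simp add: sgn_div_norm field_simps)
    also have "\<dots> = w \<bullet> (c - u)"
      using orth[OF w(2)] by (simp add: inner_diff_right inner_commute)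
    also have "\<dots> \<le> norm w * norm (u - c)"
      using norm_cauchy_schwarz[of w "c - u"] by (simp add: norm_minus_commute)
    also have "\<dots> < norm w * (\<alpha> * norm c)"
      using c \<open>w \<noteq> 0\<close> by simp
    finally show False
      by (simp add: mult_ac)
  qed
  then show ?thesis
    using assms(1) by (auto simp: dir_cone_def)
qed

lemma cone_slope_bound:
  assumes "0 < \<beta>" "\<beta> \<le> 1/4"
  shows "2 * \<beta> / sqrt (1 - (2 * \<beta>)\<^sup>2) \<le> 4 * \<beta>"
proof -
  have "(2 * \<beta>)\<^sup>2 \<le> (1/2)\<^sup>2"
    using assms by (intro power_mono) auto
  then have "(1/2)\<^sup>2 \<le> 1 - (2 * \<beta>)\<^sup>2"
    by (simp add: power2_eq_square)
  then have "1 / 2 \<le> sqrt (1 - (2 * \<beta>)\<^sup>2)"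
    by (rule real_le_rsqrt)
  then have "2 * \<beta> / sqrt (1 - (2 * \<beta>)\<^sup>2) \<le> 2 * \<beta> / (1 / 2)"
    using assms \<open>1 / 2 \<le> sqrt (1 - (2 * \<beta>)\<^sup>2)\<close>
    by (intro divide_left_mono mult_pos_pos) (linarith | simp)+
  then show ?thesis
    by simp
qed

text \<open>The cone parameter \<open>2 * \<beta>\<close> causes a slope error of at most
  \<open>4 * \<beta>\<close> and the cutoff another \<beta>; scaling by
  \<open>norm c \<le> r\<close> gives \<open>5 * r * \<beta>\<close>. If \<open>c\<close> is shorter
  than \<beta>, the zero function is used and misses \<open>c\<close> by less than \<beta>, which
  explains the additional 1.\<close>

lemma scaled_local_perturbation:
  fixes K :: "'a::euclidean_space set"
  assumes \<beta>: "0 < \<beta>" "\<beta> \<le> 1/4" and \<delta>: "0 < \<delta>" and c: "norm c \<le> r"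
    and K: "compact K" and w: "\<beta> \<le> norm c \<Longrightarrow> width (sgn c) (2 * \<beta>) K = 0"
  obtains g q where "has_gradient g q" "\<And>x. \<bar>g x\<bar> \<le> r * \<beta>"
    "\<And>x. (\<And>y. y \<in> K \<Longrightarrow> \<delta> \<le> dist x y) \<Longrightarrow> g x = 0 \<and> q x = 0"
    "\<And>x. \<exists>s. 0 \<le> s \<and> s \<le> 1 \<and> norm (q x - s *\<^sub>R c) \<le> 5 * r * \<beta>"
    "\<And>x. x \<in> K \<Longrightarrow> norm (q x - c) \<le> (5 * r + 1) * \<beta>"
proof (cases "norm c < \<beta> \<or> K = {}")
  case True
  have r: "0 \<le> r"
    using c norm_ge_zero order_trans by blast
  show thesis
  proof (rule that[OF has_gradient_const[of 0]])
    show "norm (0 - c) \<le> (5 * r + 1) * \<beta>" if "x \<in> K" for x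
    proof -
      have "norm (0 - c) \<le> 1 * \<beta>"
        using True that by auto
      also have "\<dots> \<le> (5 * r + 1) * \<beta>"
        using r \<beta> by (intro mult_right_mono) auto
      finally show ?thesis .
    qed
  qed (use r \<beta> in \<open>auto intro!: exI[of _ 0]\<close>)
next
  case False
  then have c0: "c \<noteq> 0" "K \<noteq> {}" "\<beta> \<le> norm c"
    using \<beta> by auto
  obtain g q where g: "has_gradient g q" "\<And>x. \<bar>g x\<bar> \<le> \<beta>"
    "\<And>x. \<delta> \<le> infdist x K \<Longrightarrow> g x = 0 \<and> q x = 0"
    "\<And>x. \<exists>s. 0 \<le> s \<and> s \<le> 1 \<and> norm (q x - s *\<^sub>R sgn c) \<le> 2 * \<beta> / sqrt (1 - (2 * \<beta>)\<^sup>2) + \<beta>"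
    "\<And>x. x \<in> K \<Longrightarrow> norm (q x - sgn c) \<le> 2 * \<beta> / sqrt (1 - (2 * \<beta>)\<^sup>2) + \<beta>"
    using local_perturbation[of "2 * \<beta>" "sgn c" \<beta> \<delta> K] \<beta> \<delta> K w c0 by (auto simp: norm_sgn)
  have scale: "norm (norm c *\<^sub>R q x - s *\<^sub>R c) \<le> 5 * r * \<beta>"
    if "norm (q x - s *\<^sub>R sgn c) \<le> 2 * \<beta> / sqrt (1 - (2 * \<beta>)\<^sup>2) + \<beta>" for x s
  proof -
    have "norm c *\<^sub>R q x - s *\<^sub>R c = norm c *\<^sub>R (q x - s *\<^sub>R sgn c)"
      using c0 by (simp add: sgn_div_norm algebra_simps)
    then have "norm (norm c *\<^sub>R q x - s *\<^sub>R c) = norm c * norm (q x - s *\<^sub>R sgn c)"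
      by simp
    also have "\<dots> \<le> r * (5 * \<beta>)"
      using that cone_slope_bound[OF \<beta>] c order_trans[OF norm_ge_zero c] by (intro mult_mono) auto
    finally show ?thesis
      by (simp add: mult_ac)
  qed
  show thesis
  proof (rule that[OF has_gradient_cmult[OF g(1)]])
    show "\<bar>norm c * g x\<bar> \<le> r * \<beta>" for x
      unfolding abs_mult abs_norm_cancel
      by (rule mult_mono[OF c g(2) order_trans[OF norm_ge_zero c]]) simp
    show "norm c * g x = 0 \<and> norm c *\<^sub>R q x = 0" if "\<And>y. y \<in> K \<Longrightarrow> \<delta> \<le> dist x y" for x
    proof -
      have "\<delta> \<le> infdist x K"
        using infdist_attains_inf[OF compact_imp_closed[OF K] c0(2), of x] that by metis
      then show ?thesis
        using g(3) by simp
    qed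
    show "\<exists>s. 0 \<le> s \<and> s \<le> 1 \<and> norm (norm c *\<^sub>R q x - s *\<^sub>R c) \<le> 5 * r * \<beta>" for x
      using g(4)[of x] scale by blast
    show "norm (norm c *\<^sub>R q x - c) \<le> (5 * r + 1) * \<beta>" if "x \<in> K" for x
      using scale[of x 1] g(5)[OF that] \<beta> by (simp add: algebra_simps)
  qed
qed

section \<open>Steering the gradient on most of a ball\<close>

text \<open>
  Off \<open>K\<close> the new gradient is close to a convex combination of nearby values of \<open>p\<close> and \<open>p'\<close>; this is
  why the bound \<open>M\<close> is essentially kept.
\<close>

proposition steer_gradient:
  fixes \<mu> :: "'a::euclidean_space measure" and T :: "'a \<Rightarrow> 'a set"
  assumes \<mu>: "radon_measure \<mu>" and T: "\<And>x. 0 \<in> T x"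
    and width: "\<And>e \<alpha>. norm e = 1 \<Longrightarrow> 0 < \<alpha> \<Longrightarrow> \<alpha> < 1 \<Longrightarrow>
           \<exists>N E. {x. dir_cone e \<alpha> \<inter> T x = {0}} = N \<union> E \<and>
                 N \<in> null_sets (completion \<mu>) \<and> width e \<alpha> E = 0"
    and f: "has_gradient f p" "\<And>x. norm (p x) \<le> M"
    and p': "p' \<in> borel_measurable (completion \<mu>)" "\<And>x. norm (p' x) \<le> M"
    and orth: "\<And>x w. w \<in> T x \<Longrightarrow> (p' x - p x) \<bullet> w = 0"
    and \<epsilon>: "0 < \<epsilon>"
  obtains g q K where "has_gradient g q" "\<And>x. \<bar>g x - f x\<bar> \<le> \<epsilon>" "\<And>x. norm (q x) \<le> M + \<epsilon>"
    "compact K" "emeasure \<mu> (cball 0 R - K) \<le> ennreal \<epsilon>" "\<And>x. x \<in> K \<Longrightarrow> norm (q x - p' x) \<le> \<epsilon>"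
proof -
  note sets = radon_measure_sets[OF \<mu>]
  have M: "0 \<le> M"
    using f(2)[of 0] norm_ge_zero[of "p 0"] by linarith
  \<comment> \<open>The correction \<open>p' x - p x\<close> has length at most
    \<open>2 * M\<close>, so a perturbation contributes an error \<open>10 * M * \<beta>\<close>.
    The remaining \<open>3 * \<beta>\<close> covers short vectors, the discretisation of the field
    and the oscillation of \<open>p\<close>.\<close>
  define \<beta> where "\<beta> = min (1/4) (\<epsilon> / (10 * M + 3))"
  have \<beta>: "0 < \<beta>" "\<beta> \<le> 1/4" "(10 * M + 3) * \<beta> \<le> \<epsilon>"
  proof -
    show "0 < \<beta>"
      using M \<epsilon> by (simp add: \<beta>_def)
    show "\<beta> \<le> 1/4"
      unfolding \<beta>_def by (rule min.cobounded1)
    have "\<beta> \<le> \<epsilon> / (10 * M + 3)"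
      by (simp add: \<beta>_def)
    then show "(10 * M + 3) * \<beta> \<le> \<epsilon>"
      using M by (simp add: field_simps)
  qed
  \<comment> \<open>Cones are needed only for \<open>c i\<close> of length at least \<beta>. For
    these \<open>\<eta> \<le> \<beta> * norm (c i)\<close>, so the error is small relative to the
    axis, as \<open>dir_cone_inter_orthogonal\<close> demands.\<close>
  define \<eta> where "\<eta> = \<beta> * \<beta>"
  have \<eta>: "0 < \<eta>" "\<eta> \<le> \<beta>"
    using \<beta> mult_left_mono[of \<beta> 1 \<beta>] by (auto simp: \<eta>_def)
  define u where "u x = p' x - p x" for x
  have "p \<in> borel_measurable borel"
    using f(1) by (intro borel_measurable_continuous_onI) (simp add: has_gradient_def)
  then have "p \<in> borel_measurable (completion \<mu>)"
    by (intro measurable_completion) (simp add: measurable_cong_sets[OF sets refl])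
  then have u_meas: "u \<in> borel_measurable (completion \<mu>)"
    unfolding u_def using p'(1) by (intro borel_measurable_diff)
  have u_bound: "norm (u x) \<le> 2 * M" for x
    unfolding u_def using norm_triangle_ineq4[of "p' x" "p x"] f(2)[of x] p'(2)[of x] by linarith
  have ball: "cball 0 R \<in> sets (completion \<mu>)"
    using sets by (intro sets_completionI_sets) auto
  obtain n :: nat and c A where A: "\<And>i. A i \<in> sets (completion \<mu>)" "\<And>i. A i \<subseteq> cball 0 R" "cball 0 R \<subseteq> (\<Union>i<n. A i)"
    "\<And>i j x. x \<in> A i \<Longrightarrow> x \<in> A j \<Longrightarrow> i = j" "\<And>i x. x \<in> A i \<Longrightarrow> norm (u x - c i) < \<eta>"
    "\<And>i. i < n \<Longrightarrow> norm (c i) \<le> 2 * M"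
    by (rule finite_partition_by_value[OF u_meas u_bound ball \<eta>(1)]) (rule that; assumption)
  \<comment> \<open>On \<open>A i\<close> the correction is almost \<open>c i\<close>, so the cone
    around \<open>sgn (c i)\<close> misses \<open>T x\<close> except at 0. Removal of a null set
    leaves a set of width 0, which contains a compact set of almost full measure; each of the
    \<open>n\<close> pieces may lose \<open>\<epsilon> / n\<close>.\<close>
  have "\<exists>K. compact K \<and> K \<subseteq> A i \<and> emeasure (completion \<mu>) (A i - K) \<le> ennreal (\<epsilon> / n) \<and>
      (\<beta> \<le> norm (c i) \<longrightarrow> width (sgn (c i)) (2 * \<beta>) K = 0)" if i: "i < n" for i
  proof -
    have "\<exists>N\<in>null_sets (completion \<mu>). \<beta> \<le> norm (c i) \<longrightarrow> width (sgn (c i)) (2 * \<beta>) (A i - N) = 0"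
    proof (cases "\<beta> \<le> norm (c i)")
      case True
      then have ci: "norm (sgn (c i)) = 1"
        using \<beta> by (auto simp: norm_sgn)
      obtain N E where NE: "{x. dir_cone (sgn (c i)) (2 * \<beta>) \<inter> T x = {0}} = N \<union> E"
        "N \<in> null_sets (completion \<mu>)" "width (sgn (c i)) (2 * \<beta>) E = 0"
        using width[OF ci, of "2 * \<beta>"] \<beta> by auto
      have "A i \<subseteq> {x. dir_cone (sgn (c i)) (2 * \<beta>) \<inter> T x = {0}}"
      proof clarify
        fix x assume x: "x \<in> A i"
        show "dir_cone (sgn (c i)) (2 * \<beta>) \<inter> T x = {0}"
        proof (rule dir_cone_inter_orthogonal[OF T])
          show "u x \<bullet> w = 0" if "w \<in> T x" for w
            using orth[OF that] by (simp add: u_def)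
          have "\<eta> \<le> \<beta> * norm (c i)"
            using True \<beta> by (simp add: \<eta>_def)
          also have "\<dots> \<le> 2 * \<beta> * norm (c i)"
            using \<beta> by simp
          finally show "norm (u x - c i) < 2 * \<beta> * norm (c i)"
            using A(5)[OF x] by simp
        qed
      qed
      then have "A i - N \<subseteq> E"
        using NE(1) by blast
      then have "width (sgn (c i)) (2 * \<beta>) (A i - N) = 0"
        using width_mono[of "A i - N" E "sgn (c i)" "2 * \<beta>"] NE(3) by simp
      then show ?thesis
        using NE(2) by blast
    qed auto
    then obtain N where N: "N \<in> null_sets (completion \<mu>)"
      "\<beta> \<le> norm (c i) \<Longrightarrow> width (sgn (c i)) (2 * \<beta>) (A i - N) = 0"
      by blast
    obtain K where K: "compact K" "K \<subseteq> A i - N" "emeasure (completion \<mu>) (A i - K) \<le> ennreal (\<epsilon> / n)"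
      using completion_inner_regular[OF \<mu> A(1,2) N(1), of "\<epsilon> / n" i] \<epsilon> i by auto
    have "width (sgn (c i)) (2 * \<beta>) K = 0" if "\<beta> \<le> norm (c i)"
      using width_mono[OF K(2), of "sgn (c i)" "2 * \<beta>"] N(2)[OF that] by simp
    then show ?thesis
      using K by blast
  qed
  then obtain K where K: "\<And>i. i < n \<Longrightarrow> compact (K i)" "\<And>i. i < n \<Longrightarrow> K i \<subseteq> A i"
    "\<And>i. i < n \<Longrightarrow> emeasure (completion \<mu>) (A i - K i) \<le> ennreal (\<epsilon> / n)"
    "\<And>i. i < n \<Longrightarrow> \<beta> \<le> norm (c i) \<Longrightarrow> width (sgn (c i)) (2 * \<beta>) (K i) = 0"
    by metis
  have "K i \<inter> K j = {}" if "i < n" "j < n" "i \<noteq> j" for i j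
    using K(2) A(4) that by blast
  then obtain \<delta>0 where \<delta>0: "0 < \<delta>0"
    "\<And>i j x y. i < n \<Longrightarrow> j < n \<Longrightarrow> i \<noteq> j \<Longrightarrow> x \<in> K i \<Longrightarrow> y \<in> K j \<Longrightarrow> \<delta>0 \<le> dist x y"
    using separate_finitely_many_compacts[of n K] K(1) by metis
  have "uniformly_continuous_on (cball 0 (R + 1)) p"
    using f(1) by (intro compact_uniformly_continuous)
      (auto simp: has_gradient_def intro: continuous_on_subset)
  then obtain \<delta>1 where \<delta>1: "0 < \<delta>1"
    "\<And>x y. x \<in> cball 0 (R + 1) \<Longrightarrow> y \<in> cball 0 (R + 1) \<Longrightarrow> dist y x < \<delta>1 \<Longrightarrow> dist (p y) (p x) < \<eta>"
    unfolding uniformly_continuous_on_def using \<eta>(1) by meson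
  \<comment> \<open>Half of \<open>\<delta>0\<close> makes the neighbourhoods of the pieces
    disjoint, so at most one perturbation acts at each point. The bounds \<open>\<delta>1\<close>
    and 1 control the oscillation of \<open>p\<close> near the pieces.\<close>
  define \<delta> where "\<delta> = min (\<delta>0 / 2) (min \<delta>1 1)"
  have \<delta>: "0 < \<delta>" "2 * \<delta> \<le> \<delta>0" "\<delta> \<le> \<delta>1" "\<delta> \<le> 1"
    using \<delta>0(1) \<delta>1(1) by (auto simp: \<delta>_def)
  have p_near: "norm (p y - p x) \<le> \<eta>" if "x \<in> K i" "i < n" "dist y x < \<delta>" for x y i
  proof -
    have x: "norm x \<le> R"
      using K(2)[OF that(2)] A(2)[of i] that(1) by auto
    moreover have "norm y \<le> R + 1"
      using x that(3) \<delta>(4) norm_triangle_ineq2[of y x] by (simp add: dist_norm)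
    ultimately have "dist (p y) (p x) < \<eta>"
      using that(3) \<delta>(3) by (intro \<delta>1(2)) auto
    then show ?thesis
      by (simp add: dist_norm)
  qed
  define perturbs where "perturbs i g q \<longleftrightarrow> has_gradient g q \<and> (\<forall>x. \<bar>g x\<bar> \<le> 2 * M * \<beta>) \<and>
    (\<forall>x. (\<forall>y\<in>K i. \<delta> \<le> dist x y) \<longrightarrow> g x = 0 \<and> q x = 0) \<and>
    (\<forall>x. \<exists>s. 0 \<le> s \<and> s \<le> 1 \<and> norm (q x - s *\<^sub>R c i) \<le> 5 * (2 * M) * \<beta>) \<and>
    (\<forall>x\<in>K i. norm (q x - c i) \<le> (5 * (2 * M) + 1) * \<beta>)" for i g q
  have "\<exists>g q. perturbs i g q" if i: "i < n" for i
    unfolding perturbs_def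
    by (rule scaled_local_perturbation[OF \<beta>(1,2) \<delta>(1) A(6)[OF i] K(1)[OF i] K(4)[OF i]]) blast+
  then obtain h r where "\<And>i. i < n \<Longrightarrow> perturbs i (h i) (r i)"
    by metis
  then have h: "\<And>i. i < n \<Longrightarrow> has_gradient (h i) (r i)"
    "\<And>i x. i < n \<Longrightarrow> \<bar>h i x\<bar> \<le> 2 * M * \<beta>"
    "\<And>i x. i < n \<Longrightarrow> \<forall>y\<in>K i. \<delta> \<le> dist x y \<Longrightarrow> h i x = 0 \<and> r i x = 0"
    "\<And>i x. i < n \<Longrightarrow> \<exists>s. 0 \<le> s \<and> s \<le> 1 \<and> norm (r i x - s *\<^sub>R c i) \<le> 10 * M * \<beta>"
    "\<And>i x. i < n \<Longrightarrow> x \<in> K i \<Longrightarrow> norm (r i x - c i) \<le> (10 * M + 1) * \<beta>"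
    by (simp_all add: perturbs_def)
  define g where "g x = f x + (\<Sum>i<n. h i x)" for x
  define q where "q x = p x + (\<Sum>i<n. r i x)" for x
  have single: "g y = f y + h i y \<and> q y = p y + r i y" if i: "i < n" "x \<in> K i" "dist y x < \<delta>" for i x y
  proof -
    have "h j y = 0 \<and> r j y = 0" if j: "j < n" "j \<noteq> i" for j
    proof (rule h(3)[OF j(1)], rule ballI)
      fix z assume z: "z \<in> K j"
      have "\<delta>0 \<le> dist z x"
        using \<delta>0(2)[OF j(1) i(1) j(2) z i(2)] .
      also have "\<dots> \<le> dist y z + dist y x"
        by (metis dist_commute dist_triangle2)
      finally show "\<delta> \<le> dist y z"
        using i(3) \<delta>(2) by simp
    qed
    then have "(\<Sum>j<n. h j y) = h i y" "(\<Sum>j<n. r j y) = r i y"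
      using i(1) by (subst sum.remove[of _ i]; force)+
    then show ?thesis
      by (simp add: g_def q_def)
  qed
  have cases: "(g y = f y \<and> q y = p y) \<or> (\<exists>i x. i < n \<and> x \<in> K i \<and> dist y x < \<delta>)" for y
  proof (rule disjCI)
    assume "\<not> (\<exists>i x. i < n \<and> x \<in> K i \<and> dist y x < \<delta>)"
    then have "\<forall>i<n. h i y = 0 \<and> r i y = 0"
      using h(3) by (meson not_le)
    then show "g y = f y \<and> q y = p y"
      by (simp add: g_def q_def)
  qed
  show thesis
  proof (rule that[of g q "\<Union>i<n. K i"])
    show "has_gradient g q"
      unfolding g_def q_def using f(1) h(1) by (intro has_gradient_add has_gradient_sum) auto
    show "\<bar>g y - f y\<bar> \<le> \<epsilon>" for y
    proof -
      have "\<bar>g y - f y\<bar> \<le> 2 * M * \<beta>"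
        using cases[of y] single[of _ _ y] h(2)[of _ y] M \<beta>(1) by fastforce
      then show ?thesis
        using \<beta>(1,3) M mult_nonneg_nonneg[of M \<beta>] by (simp add: algebra_simps)
    qed
    show "norm (q y) \<le> M + \<epsilon>" for y
    proof (cases "q y = p y")
      case True
      then show ?thesis
        using f(2)[of y] \<epsilon> by simp
    next
      case False
      then obtain i x where i: "i < n" "x \<in> K i" "dist y x < \<delta>"
        using cases[of y] by blast
      obtain s where s: "0 \<le> s" "s \<le> 1" "norm (r i y - s *\<^sub>R c i) \<le> 10 * M * \<beta>"
        using h(4)[OF i(1)] by blast
      \<comment> \<open>The comparison is made at the nearby point \<open>x\<close> of the piece:
        \<open>p'\<close> is merely measurable, and at \<open>y\<close> it need not be related to
        \<open>c i\<close>.\<close>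
      define z where "z = (1 - s) *\<^sub>R p x + s *\<^sub>R p' x"
      have "norm (u x - c i) < \<eta>"
        using A(5) K(2)[OF i(1)] i(2) by blast
      then have "norm (s *\<^sub>R (c i - u x)) \<le> 1 * \<eta>"
        using s(1,2) by (simp only: norm_scaleR abs_of_nonneg norm_minus_commute) (intro mult_mono, auto)
      moreover have "norm z \<le> (1 - s) * M + s * M"
        unfolding z_def using s f(2)[of x] p'(2)[of x] by (intro norm_triangle_le) (auto intro!: add_mono mult_left_mono)
      moreover have "q y = z + (p y - p x) + s *\<^sub>R (c i - u x) + (r i y - s *\<^sub>R c i)"
        using single[OF i] by (simp add: z_def u_def algebra_simps)
      ultimately have "norm (q y) \<le> ((1 - s) * M + s * M) + \<eta> + 1 * \<eta> + 10 * M * \<beta>"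
        using p_near[OF i(2,1,3)] s(3) by (simp only:) (intro norm_triangle_mono)
      also have "\<dots> \<le> M + (10 * M + 3) * \<beta>"
        using \<eta>(2) \<beta>(1) by (simp add: algebra_simps)
      finally show ?thesis
        using \<beta>(3) by simp
    qed
    show "compact (\<Union>i<n. K i)"
      using K(1) by (intro compact_UN) auto
    show "norm (q x - p' x) \<le> \<epsilon>" if x: "x \<in> (\<Union>i<n. K i)" for x
    proof -
      obtain i where i: "i < n" "x \<in> K i"
        using x by blast
      have "q x - p' x = (r i x - c i) + (c i - u x)"
        using single[OF i, of x] \<delta>(1) by (simp add: u_def)
      moreover have "norm (c i - u x) \<le> \<eta>"
        using A(5)[of x i] K(2)[OF i(1)] i(2) by (auto simp: norm_minus_commute)
      ultimately have "norm (q x - p' x) \<le> (10 * M + 1) * \<beta> + \<eta>"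
        using h(5)[OF i] by (simp only:) (intro norm_triangle_mono)
      also have "\<dots> \<le> (10 * M + 3) * \<beta>"
        using \<eta>(2) \<beta>(1) by (simp add: algebra_simps)
      finally show ?thesis
        using \<beta>(3) by simp
    qed
    show "emeasure \<mu> (cball 0 R - (\<Union>i<n. K i)) \<le> ennreal \<epsilon>"
    proof -
      have Ks: "K i \<in> sets (completion \<mu>)" if "i < n" for i
        using K(1)[OF that] sets by (intro sets_completionI_sets) (simp add: borel_compact)
      have "(\<Union>i<n. K i) \<in> sets \<mu>"
        using K(1) sets by (intro sets.finite_UN) (auto simp: borel_compact)
      then have "emeasure \<mu> (cball 0 R - (\<Union>i<n. K i)) = emeasure (completion \<mu>) (cball 0 R - (\<Union>i<n. K i))"
        using sets by simp
      also have "\<dots> \<le> emeasure (completion \<mu>) (\<Union>i<n. A i - K i)"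
      proof (rule emeasure_mono)
        show "cball 0 R - (\<Union>i<n. K i) \<subseteq> (\<Union>i<n. A i - K i)"
          using A(3) by blast
        show "(\<Union>i<n. A i - K i) \<in> sets (completion \<mu>)"
          using A(1) Ks by (intro sets.finite_UN) auto
      qed
      also have "\<dots> \<le> (\<Sum>i<n. emeasure (completion \<mu>) (A i - K i))"
        using A(1) Ks by (intro emeasure_subadditive_finite) auto
      also have "\<dots> \<le> (\<Sum>i<n. ennreal (\<epsilon> / n))"
        using K(3) by (intro sum_mono) auto
      also have "\<dots> = ennreal (\<Sum>i<n. \<epsilon> / n)"
        using \<epsilon> by (intro sum_ennreal) auto
      also have "\<dots> \<le> ennreal \<epsilon>"
        using \<epsilon> by (intro ennreal_leI) auto
      finally show ?thesis .
    qed
  qed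
qed

section \<open>Orthogonal projections onto subspaces\<close>

text \<open>The variational inequality for closest points of convex sets, tested with a vector of
  \<open>V\<close> and its negative, becomes an equality.\<close>

lemma closest_point_subspace:
  fixes V :: "'a::euclidean_space set"
  assumes V: "subspace V"
  shows "closest_point V a \<in> V" and "v \<in> V \<Longrightarrow> (a - closest_point V a) \<bullet> v = 0"
proof -
  have props: "closed V" "convex V" "V \<noteq> {}"
    using V subspace_0[OF V] by (auto simp: closed_subspace subspace_imp_convex)
  show mem: "closest_point V a \<in> V"
    using closest_point_exists(1)[OF props(1,3)] .
  have "(a - closest_point V a) \<bullet> w \<le> 0" if "w \<in> V" for w
    using closest_point_dot[OF props(2,1) subspace_add[OF V that mem], of a] by simp
  from this[of v] this[of "- v"] show "(a - closest_point V a) \<bullet> v = 0" if "v \<in> V"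
    using that subspace_neg[OF V that] by simp
qed

lemma closest_point_subspace_unique:
  fixes V :: "'a::euclidean_space set"
  assumes V: "subspace V" and b: "b \<in> V" "\<And>v. v \<in> V \<Longrightarrow> (a - b) \<bullet> v = 0"
  shows "closest_point V a = b"
proof -
  have d: "closest_point V a - b \<in> V"
    using closest_point_subspace(1)[OF V] b(1) V by (simp add: subspace_diff)
  have "(closest_point V a - b) \<bullet> (closest_point V a - b) = 0"
    using b(2)[OF d] closest_point_subspace(2)[OF V d, of a] by (simp add: inner_diff_left)
  then show ?thesis
    by simp
qed

lemma linear_closest_point_subspace:
  fixes V :: "'a::euclidean_space set"
  assumes V: "subspace V"
  shows "linear (closest_point V)"
proof (rule linearI)
  note P = closest_point_subspace[OF V]
  show "closest_point V (a + b) = closest_point V a + closest_point V b" for a b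
  proof (rule closest_point_subspace_unique[OF V])
    show "(a + b - (closest_point V a + closest_point V b)) \<bullet> v = 0" if "v \<in> V" for v
      using P(2)[OF that, of a] P(2)[OF that, of b] by (simp add: inner_diff_left inner_add_left)
  qed (simp add: P(1) subspace_add[OF V])
  show "closest_point V (r *\<^sub>R a) = r *\<^sub>R closest_point V a" for r a
  proof (rule closest_point_subspace_unique[OF V])
    show "(r *\<^sub>R a - r *\<^sub>R closest_point V a) \<bullet> v = 0" if "v \<in> V" for v
      using P(2)[OF that, of a] by (simp add: inner_diff_left)
  qed (simp add: P(1) subspace_scale[OF V])
qed

lemma norm_closest_point_subspace:
  fixes V :: "'a::euclidean_space set"
  assumes V: "subspace V"
  shows "norm (closest_point V a) \<le> norm a" "norm (a - closest_point V a) \<le> norm a"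
proof -
  have "norm (closest_point V a + (a - closest_point V a)) ^ 2 =
      norm (closest_point V a) ^ 2 + norm (a - closest_point V a) ^ 2"
    by (rule norm_add_Pythagorean)
      (use closest_point_subspace(2)[OF V closest_point_subspace(1)[OF V], of a a] in
        \<open>simp add: orthogonal_def inner_commute\<close>)
  then have "norm (closest_point V a) ^ 2 \<le> norm a ^ 2" "norm (a - closest_point V a) ^ 2 \<le> norm a ^ 2"
    by simp_all
  then show "norm (closest_point V a) \<le> norm a" "norm (a - closest_point V a) \<le> norm a"
    by (auto intro: power2_le_imp_le)
qed

lemma infdist_subspace:
  fixes V :: "'a::euclidean_space set"
  assumes V: "subspace V"
  shows "infdist a V = norm (a - closest_point V a)"
proof -
  have "V \<noteq> {}"
    using subspace_0[OF V] by auto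
  then show ?thesis
    using setdist_closest_point[OF closed_subspace[OF V], of a]
    by (simp add: infdist_eq_setdist dist_norm)
qed

lemma all_subspaces_imp_subspace: "V \<in> all_subspaces \<Longrightarrow> subspace V"
  by (auto simp: all_subspaces_def Grassmannian_def)

lemma space_subspaces_borel: "space subspaces_borel = all_subspaces"
  by (simp add: subspaces_borel_def space_measure_of_conv)

text \<open>For fixed \<open>b\<close> the map is Lipschitz with constant \<open>norm b\<close> for
  \<open>subspace_dist\<close>, by the operator norm bound, so preimages of open sets are open. In
  the radius, \<open>norm b + 1\<close> allows \<open>b = 0\<close>.\<close>

lemma borel_measurable_closest_point_subspaces:
  "(\<lambda>V. closest_point V b) \<in> borel_measurable (subspaces_borel :: 'a::euclidean_space set measure)"
proof (rule borel_measurableI)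
  fix S :: "'a set" assume S: "open S"
  let ?B = "(\<lambda>V. closest_point V b) -` S \<inter> all_subspaces"
  have "subspaces_open ?B"
    unfolding subspaces_open_def
  proof (intro conjI ballI)
    fix V assume "V \<in> ?B"
    then have V: "closest_point V b \<in> S" "subspace V"
      by (auto dest: all_subspaces_imp_subspace)
    then obtain \<epsilon> where \<epsilon>: "0 < \<epsilon>" "ball (closest_point V b) \<epsilon> \<subseteq> S"
      using S by (meson open_contains_ball)
    show "\<exists>r>0. \<forall>W\<in>all_subspaces. subspace_dist V W < r \<longrightarrow> W \<in> ?B"
    proof (intro exI conjI ballI impI)
      show "0 < \<epsilon> / (norm b + 1)"
        using \<epsilon> by (simp add: add_nonneg_pos)
      fix W assume W: "W \<in> all_subspaces" "subspace_dist V W < \<epsilon> / (norm b + 1)"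
      have "bounded_linear (\<lambda>x. closest_point V x - closest_point W x)"
        using V(2) all_subspaces_imp_subspace[OF W(1)]
        by (intro bounded_linear_sub linear_conv_bounded_linear[THEN iffD1] linear_closest_point_subspace)
      then have "norm (closest_point V b - closest_point W b) \<le> subspace_dist V W * norm b"
        unfolding subspace_dist_def by (rule onorm)
      also have "\<dots> \<le> \<epsilon> / (norm b + 1) * norm b"
        using W(2) by (intro mult_right_mono) auto
      also have "\<dots> < \<epsilon>"
        using \<epsilon>(1) by (simp add: divide_less_eq add_nonneg_pos)
      finally have "closest_point W b \<in> S"
        using \<epsilon>(2) by (auto simp: dist_norm)
      then show "W \<in> ?B"
        using W(1) by simp
    qed
  qed auto
  then show "(\<lambda>V. closest_point V b) -` S \<inter> space subspaces_borel \<in> sets subspaces_borel"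
    unfolding space_subspaces_borel unfolding subspaces_borel_def
    by (subst sets_measure_of) (auto simp: subspaces_open_def)
qed

section \<open>Limits along sequences of scales, and targets for the gradient\<close>

lemma Liminf_le_limit_along_sequence:
  fixes g :: "real \<Rightarrow> real"
  assumes t: "\<And>k. 0 < t k" "t \<longlonglongrightarrow> 0" and lim: "(\<lambda>k. g (t k)) \<longlonglongrightarrow> l"
  shows "Liminf (at_right 0) (\<lambda>s. ereal (g s)) \<le> ereal l" (is ?thesis1)
    and "ereal l \<le> Limsup (at_right 0) (\<lambda>s. ereal (g s))" (is ?thesis2)
proof -
  have le: "filtermap t sequentially \<le> at_right 0"
    using t unfolding filterlim_def[symmetric] by (intro filterlim_at_withinI) auto
  have lim': "(\<lambda>k. ereal (g (t k))) \<longlonglongrightarrow> ereal l"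
    using lim by simp
  have "Liminf (at_right 0) (\<lambda>s. ereal (g s)) \<le> Liminf (filtermap t sequentially) (\<lambda>s. ereal (g s))"
    unfolding Liminf_def using le by (intro SUP_subset_mono) (auto dest: filter_leD)
  also have "\<dots> \<le> liminf (\<lambda>k. ereal (g (t k)))"
    by (rule Liminf_filtermap_le)
  finally show ?thesis1
    using lim_imp_Liminf[OF _ lim'] by simp
  have "limsup (\<lambda>k. ereal (g (t k))) \<le> Limsup (filtermap t sequentially) (\<lambda>s. ereal (g s))"
    by (rule Limsup_filtermap_ge)
  also have "\<dots> \<le> Limsup (at_right 0) (\<lambda>s. ereal (g s))"
    unfolding Limsup_def using le by (intro INF_superset_mono) (auto dest: filter_leD)
  finally show ?thesis2
    using lim_imp_Limsup[OF _ lim'] by simp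
qed

text \<open>The enumeration cycles through a list of the elements. Recurrence is what makes every
  direction a target at arbitrarily small scales.\<close>

lemma exists_recurrent_enumeration:
  assumes "finite B" "B \<noteq> {}"
  obtains b :: "nat \<Rightarrow> 'a" where "range b \<subseteq> B" "\<And>c. c \<in> B \<Longrightarrow> infinite {k. b k = c}"
proof -
  obtain xs where xs: "set xs = B"
    using finite_list[OF assms(1)] by blast
  have len: "0 < length xs"
    using assms(2) xs by auto
  show thesis
  proof (rule that[of "\<lambda>k. xs ! (k mod length xs)"])
    show "range (\<lambda>k. xs ! (k mod length xs)) \<subseteq> B"
      using len xs by (auto intro: nth_mem)
    fix c assume "c \<in> B"
    then obtain i where i: "i < length xs" "xs ! i = c"
      using xs by (metis in_set_conv_nth)
    show "infinite {k. xs ! (k mod length xs) = c}"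
      unfolding infinite_nat_iff_unbounded_le
    proof
      fix m
      have "m \<le> i + length xs * m"
        using len by (cases "length xs") auto
      moreover have "i + length xs * m \<in> {k. xs ! (k mod length xs) = c}"
        using i by simp
      ultimately show "\<exists>n\<ge>m. n \<in> {k. xs ! (k mod length xs) = c}"
        by blast
    qed
  qed
qed

text \<open>
  The component along \<open>T x\<close> of the gradient cannot be controlled; the remaining length, up to the
  bound \<open>M\<close>, is spent in the direction of the component of \<open>b\<close> orthogonal to \<open>T x\<close>.
\<close>

definition target :: "('a::euclidean_space \<Rightarrow> 'a set) \<Rightarrow> ('a \<Rightarrow> 'a) \<Rightarrow> real \<Rightarrow> 'a \<Rightarrow> 'a \<Rightarrow> 'a" where
  "target T p M b x = closest_point (T x) (p x)
     + (M - norm (closest_point (T x) (p x))) *\<^sub>R (b - closest_point (T x) b)"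

text \<open>The first two properties make the target an admissible field for
  \<open>steer_gradient\<close>. By the third, aiming at it leaves the tangential part of the
  gradient in place.\<close>

lemma target_props:
  assumes V: "subspace (T x)" and p: "norm (p x) \<le> M" and b: "norm b \<le> 1"
  shows "norm (target T p M b x) \<le> M"
    and "w \<in> T x \<Longrightarrow> (target T p M b x - p x) \<bullet> w = 0"
    and "closest_point (T x) (target T p M b x) = closest_point (T x) (p x)"
proof -
  let ?P = "closest_point (T x)"
  note P = closest_point_subspace[OF V]
  have M: "norm (?P (p x)) \<le> M"
    using norm_closest_point_subspace(1)[OF V, of "p x"] p by linarith
  have "norm ((M - norm (?P (p x))) *\<^sub>R (b - ?P b)) \<le> (M - norm (?P (p x))) * 1"
    using M norm_closest_point_subspace(2)[OF V, of b] b unfolding norm_scaleR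
    by (intro mult_mono) auto
  then show "norm (target T p M b x) \<le> M"
    unfolding target_def by (intro norm_triangle_le) simp
  show orth: "(target T p M b x - p x) \<bullet> w = 0" if w: "w \<in> T x" for w
    using P(2)[OF w, of "p x"] P(2)[OF w, of b]
    by (simp add: target_def inner_diff_left inner_add_left)
  show "?P (target T p M b x) = ?P (p x)"
    using P(1)
    by (rule closest_point_subspace_unique[OF V])
      (use P(2)[of _ "p x"] orth in \<open>simp add: inner_diff_left\<close>)
qed

text \<open>The projection is linear in the projected vector, so expanding \<open>p x\<close> in the
  basis leaves only projections of fixed vectors, where just the subspace varies.\<close>

lemma target_measurable:
  fixes T :: "'a::euclidean_space \<Rightarrow> 'a set"
  assumes T: "T \<in> measurable M subspaces_borel" and sub: "\<And>x. subspace (T x)"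
    and p: "p \<in> borel_measurable M"
  shows "target T p c b \<in> borel_measurable M"
proof -
  have P: "(\<lambda>x. closest_point (T x) a) \<in> borel_measurable M" for a
    by (rule measurable_compose[OF T borel_measurable_closest_point_subspaces])
  have "closest_point (T x) (p x) = (\<Sum>a\<in>Basis. (p x \<bullet> a) *\<^sub>R closest_point (T x) a)" for x
  proof -
    note lin = linear_closest_point_subspace[OF sub[of x]]
    have "closest_point (T x) (p x) = closest_point (T x) (\<Sum>a\<in>Basis. (p x \<bullet> a) *\<^sub>R a)"
      by (simp add: euclidean_representation)
    also have "\<dots> = (\<Sum>a\<in>Basis. (p x \<bullet> a) *\<^sub>R closest_point (T x) a)"
      by (simp add: linear_sum[OF lin] linear_scale[OF lin])
    finally show ?thesis .
  qed
  then have "(\<lambda>x. closest_point (T x) (p x)) \<in> borel_measurable M"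
    using P p by simp
  then show ?thesis
    unfolding target_def[abs_def] using P by measurable
qed

section \<open>The iteration\<close>

text \<open>At scale \<open>r k\<close>, on the ball of radius \<open>k\<close>, the function
  \<open>f k\<close> is affine up to the relative error \<open>(1/2)^k\<close>. The factor
  \<open>r k\<close> in the last assumption keeps later changes negligible at that scale.\<close>

locale steering_sequence =
  fixes T :: "'a::euclidean_space \<Rightarrow> 'a set" and b :: "nat \<Rightarrow> 'a"
    and f :: "nat \<Rightarrow> 'a \<Rightarrow> real" and p :: "nat \<Rightarrow> 'a \<Rightarrow> 'a" and r :: "nat \<Rightarrow> real"
  assumes subspace_T: "\<And>x. subspace (T x)"
    and norm_b: "\<And>k. norm (b k) \<le> 1"
    and recurrent: "\<And>c. c \<in> insert 0 Basis \<Longrightarrow> infinite {k. b k = c}"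
    and gradient: "\<And>k. has_gradient (f k) (p k)"
    and bound: "\<And>k x. norm (p k x) \<le> 2 - (1/2)^k"
    and r_pos: "\<And>k. 0 < r k" and r_le: "\<And>k. r k \<le> (1/2)^k" and r_Suc: "\<And>k. r (Suc k) \<le> r k"
    and taylor: "\<And>k x w. norm x \<le> real k \<Longrightarrow> norm w \<le> r k \<Longrightarrow>
      \<bar>f k (x + w) - f k x - p k x \<bullet> w\<bar> \<le> (1/2)^k * norm w"
    and close: "\<And>k x. \<bar>f (Suc k) x - f k x\<bar> \<le> (1/2)^k * r k / 2"
begin

definition limit_fun :: "'a \<Rightarrow> real" where
  "limit_fun x = lim (\<lambda>k. f k x)"

text \<open>For \<open>a k = (1/2)^k * r k\<close> one step changes the function by at most
  \<open>a k / 2\<close>, and \<open>a (Suc k) \<le> a k / 2\<close> as \<open>r\<close> does not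
  increase. So a step is at most \<open>a k - a (Suc k)\<close>, and the sum telescopes.\<close>

lemma close_from:
  assumes "k \<le> m"
  shows "\<bar>f m x - f k x\<bar> \<le> (1/2)^k * r k - (1/2)^m * r m"
  using assms
proof (induction m rule: dec_induct)
  case (step m)
  have "(1/2)^m * r (Suc m) \<le> (1/2)^m * r m"
    by (intro mult_left_mono r_Suc) simp
  moreover have "(1/2)^Suc m * r (Suc m) = (1/2)^m * r (Suc m) / 2"
    by simp
  ultimately show ?case
    using step.IH close[of m x] by linarith
qed simp

lemma tendsto_limit_fun: "(\<lambda>k. f k x) \<longlonglongrightarrow> limit_fun x"
proof -
  have "Cauchy (\<lambda>k. f k x)"
  proof (rule metric_CauchyI)
    fix e :: real assume "0 < e"
    then obtain N where N: "(1/2::real)^N < e / 2"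
      using real_arch_pow_inv[of "e / 2" "1/2"] by auto
    have *: "\<bar>f m x - f N x\<bar> < e / 2" if "N \<le> m" for m
    proof -
      have "\<bar>f m x - f N x\<bar> \<le> (1/2)^N * r N - (1/2)^m * r m"
        by (rule close_from[OF that])
      also have "\<dots> \<le> (1/2)^N * 1"
      proof -
        have "r N \<le> 1"
          using r_le[of N] power_le_one[of "1/2::real" N] by simp
        then have "(1/2)^N * r N \<le> (1/2)^N * 1"
          by (intro mult_left_mono) auto
        moreover have "0 \<le> (1/2)^m * r m"
          using r_pos[of m] by simp
        ultimately show ?thesis
          by linarith
      qed
      finally show ?thesis
        using N by simp
    qed
    show "\<exists>N. \<forall>m\<ge>N. \<forall>n\<ge>N. dist (f m x) (f n x) < e"
      using * by (intro exI[of _ N]) (smt (verit) dist_real_def field_sum_of_halves)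
  qed
  then show ?thesis
    unfolding limit_fun_def by (simp add: Cauchy_convergent_iff convergent_LIMSEQ_iff)
qed

lemma limit_fun_close: "\<bar>limit_fun x - f k x\<bar> \<le> (1/2)^k * r k"
proof (rule LIMSEQ_le_const2)
  show "(\<lambda>m. \<bar>f m x - f k x\<bar>) \<longlonglongrightarrow> \<bar>limit_fun x - f k x\<bar>"
    by (intro tendsto_intros tendsto_limit_fun)
  have "\<bar>f m x - f k x\<bar> \<le> (1/2)^k * r k" if "k \<le> m" for m
  proof -
    have "0 \<le> (1/2)^m * r m"
      using r_pos[of m] by simp
    then show ?thesis
      using close_from[OF that, of x] by linarith
  qed
  then show "\<exists>N. \<forall>m\<ge>N. \<bar>f m x - f k x\<bar> \<le> (1/2)^k * r k"
    by blast
qed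

lemma lipschitz_limit_fun: "2-lipschitz_on UNIV limit_fun"
proof (rule lipschitz_onI)
  fix x y
  show "dist (limit_fun x) (limit_fun y) \<le> 2 * dist x y"
  proof (rule LIMSEQ_le_const2)
    show "(\<lambda>k. dist (f k x) (f k y)) \<longlonglongrightarrow> dist (limit_fun x) (limit_fun y)"
      by (intro tendsto_intros tendsto_limit_fun)
    have "2-lipschitz_on UNIV (f k)" for k
    proof (rule has_gradient_lipschitz[OF gradient])
      show "norm (p k x) \<le> 2" for x
        using bound[of k x] by (rule order_trans) simp
    qed
    then show "\<exists>N. \<forall>k\<ge>N. dist (f k x) (f k y) \<le> 2 * dist x y"
      by (auto dest: lipschitz_onD)
  qed
qed simp

text \<open>The radius \<open>2 - 3/4 * (1/2)^k\<close> lies midway between the gradient bounds with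
  indices \<open>k\<close> and \<open>Suc k\<close>. The tolerance is the distance to the larger
  one, so a gradient within it obeys the next bound.\<close>

definition steered :: "nat \<Rightarrow> 'a \<Rightarrow> bool" where
  "steered k x \<longleftrightarrow> norm (p (Suc k) x - target T (p k) (2 - 3/4 * (1/2)^k) (b k) x) \<le> 1/4 * (1/2)^k"

context
  fixes x :: 'a and k0 :: nat
  assumes steered: "\<And>k. k0 \<le> k \<Longrightarrow> steered k x" and k0: "norm x \<le> real k0"
begin

definition \<tau> :: "nat \<Rightarrow> 'a" where
  "\<tau> k = closest_point (T x) (p k x)"

lemma norm_p_le: "norm (p k x) \<le> 2 - 3/4 * (1/2)^k"
  using bound[of k x] by (rule order_trans) simp

text \<open>The target has tangential part \<open>\<tau> k\<close>, so only the steering error moves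
  it, and projecting does not enlarge that error.\<close>

lemma \<tau>_step:
  assumes "k0 \<le> k"
  shows "norm (\<tau> (Suc k) - \<tau> k) \<le> 1/4 * (1/2)^k"
proof -
  let ?P = "closest_point (T x)" and ?t = "target T (p k) (2 - 3/4 * (1/2)^k) (b k) x"
  have "\<tau> (Suc k) - \<tau> k = ?P (p (Suc k) x) - ?P ?t"
    using target_props(3)[of T x "p k", OF subspace_T norm_p_le norm_b] by (simp add: \<tau>_def)
  also have "\<dots> = ?P (p (Suc k) x - ?t)"
    using linear_diff[OF linear_closest_point_subspace[OF subspace_T]] by metis
  also have "norm \<dots> \<le> norm (p (Suc k) x - ?t)"
    by (rule norm_closest_point_subspace(1)[OF subspace_T])
  also have "\<dots> \<le> 1/4 * (1/2)^k"
    using steered[OF assms] by (simp add: steered_def)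
  finally show ?thesis .
qed

text \<open>At \<open>k0\<close> the gradient bound leaves the margin \<open>(1/2)^k0\<close> below
  2. The later steps use up at most half of it, since \<open>1/4 * (1/2)^k\<close> summed from
  \<open>k0\<close> gives \<open>1/2 * (1/2)^k0\<close>.\<close>

lemma norm_\<tau>_le:
  assumes "k0 \<le> k"
  shows "norm (\<tau> k) \<le> 2 - 1/2 * (1/2)^k0 - 1/2 * (1/2)^k"
  using assms
proof (induction k rule: dec_induct)
  case base
  have "norm (\<tau> k0) \<le> norm (p k0 x)"
    unfolding \<tau>_def by (rule norm_closest_point_subspace(1)[OF subspace_T])
  then show ?case
    using bound[of k0 x] by simp
next
  case (step k)
  have "norm (\<tau> (Suc k)) \<le> norm (\<tau> k) + norm (\<tau> (Suc k) - \<tau> k)"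
    by (metis add.commute diff_add_cancel norm_triangle_ineq)
  then show ?case
    using step.IH \<tau>_step[OF step.hyps(1)] by simp
qed

lemma \<tau>_limit:
  obtains t where "\<tau> \<longlonglongrightarrow> t" "norm t < 2"
proof -
  have "summable (\<lambda>k. \<tau> (Suc k) - \<tau> k)"
  proof (rule summable_comparison_test)
    show "summable (\<lambda>k. 1/4 * (1/2::real)^k)"
      by (intro summable_mult summable_geometric) simp
    show "\<exists>N. \<forall>k\<ge>N. norm (\<tau> (Suc k) - \<tau> k) \<le> 1/4 * (1/2)^k"
      using \<tau>_step by blast
  qed
  then have "convergent (\<lambda>n. \<tau> n - \<tau> 0)"
    by (simp add: summable_iff_convergent sum_lessThan_telescope)
  then have "convergent \<tau>"
    by (simp add: convergent_diff_const_right_iff)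
  then obtain t where t: "\<tau> \<longlonglongrightarrow> t"
    by (auto simp: convergent_def)
  have "norm t \<le> 2 - 1/2 * (1/2)^k0"
  proof (rule LIMSEQ_le_const2[OF tendsto_norm[OF t]])
    have "norm (\<tau> k) \<le> 2 - 1/2 * (1/2)^k0" if "k0 \<le> k" for k
      using norm_\<tau>_le[OF that] by (rule order_trans) simp
    then show "\<exists>N. \<forall>k\<ge>N. norm (\<tau> k) \<le> 2 - 1/2 * (1/2)^k0"
      by blast
  qed
  also have "\<dots> < 2"
    by simp
  finally show thesis
    using that t by blast
qed

text \<open>Dividing by \<open>norm v + 1\<close> makes the displacement no longer than
  \<open>r k\<close>, also for \<open>v = 0\<close>, while \<open>r k\<close> stays a bounded
  multiple of the step. Replacing the limit by \<open>f k\<close> at two points costs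
  \<open>2 * (norm v + 1)\<close> and linearisation costs \<open>norm v\<close>, both times
  \<open>(1/2)^k\<close>.\<close>

lemma slope_along_scales:
  defines "t \<equiv> \<lambda>v k. r k / (norm v + 1)"
  shows "0 < t v k" "t v \<longlonglongrightarrow> 0"
    "(\<lambda>k. (limit_fun (x + t v k *\<^sub>R v) - limit_fun x) / t v k - p k x \<bullet> v) \<longlonglongrightarrow> 0"
proof -
  have v1: "0 < norm v + 1"
    by (simp add: add_nonneg_pos)
  show t_pos: "0 < t v k" for k
    using r_pos[of k] v1 by (simp add: t_def)
  have half: "(\<lambda>k. (1/2::real)^k) \<longlonglongrightarrow> 0"
    by (rule LIMSEQ_power_zero) simp
  have "r \<longlonglongrightarrow> 0"
    by (rule tendsto_sandwich[OF _ _ tendsto_const half])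
      (use r_pos r_le in \<open>auto intro: always_eventually less_imp_le\<close>)
  then show "t v \<longlonglongrightarrow> 0"
    unfolding t_def by (rule tendsto_divide_zero)
  have est: "norm ((limit_fun (x + t v k *\<^sub>R v) - limit_fun x) / t v k - p k x \<bullet> v) \<le> (1/2)^k * (3 * norm v + 2)"
    if k: "k0 \<le> k" for k
  proof -
    let ?s = "t v k"
    have "norm (?s *\<^sub>R v) \<le> r k"
      using r_pos[of k] v1 t_pos[of k] by (simp add: t_def divide_le_eq)
    then have "\<bar>f k (x + ?s *\<^sub>R v) - f k x - p k x \<bullet> (?s *\<^sub>R v)\<bar> \<le> (1/2)^k * norm (?s *\<^sub>R v)"
      using k0 k by (intro taylor) auto
    then have "\<bar>f k (x + ?s *\<^sub>R v) - f k x - ?s * (p k x \<bullet> v)\<bar> \<le> (1/2)^k * (?s * norm v)"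
      using t_pos[of k] by simp
    then have "\<bar>limit_fun (x + ?s *\<^sub>R v) - limit_fun x - ?s * (p k x \<bullet> v)\<bar>
        \<le> 2 * ((1/2)^k * r k) + (1/2)^k * (?s * norm v)"
      using limit_fun_close[of "x + ?s *\<^sub>R v" k] limit_fun_close[of x k] by linarith
    also have "r k = ?s * (norm v + 1)"
      using v1 by (simp add: t_def)
    also have "2 * ((1/2)^k * (?s * (norm v + 1))) + (1/2)^k * (?s * norm v) = (1/2)^k * (3 * norm v + 2) * ?s"
      by (simp add: algebra_simps)
    finally have "\<bar>limit_fun (x + ?s *\<^sub>R v) - limit_fun x - ?s * (p k x \<bullet> v)\<bar> / ?s \<le> (1/2)^k * (3 * norm v + 2)"
      using t_pos[of k] by (simp add: pos_divide_le_eq)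
    moreover have "(limit_fun (x + ?s *\<^sub>R v) - limit_fun x) / ?s - p k x \<bullet> v
        = (limit_fun (x + ?s *\<^sub>R v) - limit_fun x - ?s * (p k x \<bullet> v)) / ?s"
      using t_pos[of k] by (simp add: diff_divide_distrib)
    ultimately show ?thesis
      using t_pos[of k] by simp
  qed
  show "(\<lambda>k. (limit_fun (x + t v k *\<^sub>R v) - limit_fun x) / t v k - p k x \<bullet> v) \<longlonglongrightarrow> 0"
  proof (rule Lim_null_comparison)
    show "\<forall>\<^sub>F k in sequentially. norm ((limit_fun (x + t v k *\<^sub>R v) - limit_fun x) / t v k - p k x \<bullet> v)
        \<le> (1/2)^k * (3 * norm v + 2)"
      using est eventually_sequentially by blast
    show "(\<lambda>k. (1/2)^k * (3 * norm v + 2)) \<longlonglongrightarrow> 0"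
      by (intro tendsto_mult_left_zero half)
  qed
qed

text \<open>Along the indices with \<open>b k = c\<close> the gradients approach their targets,
  which converge because \<tau> does. The slopes of the limit function at the matching scales have
  the same limit \<open>L\<close>.\<close>

lemma derivative_bounds:
  fixes v :: 'a
  assumes t: "\<tau> \<longlonglongrightarrow> t" and c: "c \<in> insert 0 Basis"
  defines "L \<equiv> (t + (2 - norm t) *\<^sub>R (c - closest_point (T x) c)) \<bullet> v"
  shows "lower_dir_deriv limit_fun x v \<le> ereal L" "ereal L \<le> upper_dir_deriv limit_fun x v"
proof -
  define \<sigma> where "\<sigma> = enumerate {k. b k = c}"
  have \<sigma>: "strict_mono \<sigma>" "\<And>j. b (\<sigma> j) = c"
    using recurrent[OF c] enumerate_in_set[of "{k. b k = c}"]
    by (auto simp: \<sigma>_def strict_mono_enumerate)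
  have \<sigma>_lim: "filterlim \<sigma> sequentially sequentially"
    by (rule filterlim_subseq[OF \<sigma>(1)])
  have half: "(\<lambda>k. a * (1/2::real)^k) \<longlonglongrightarrow> 0" for a
    by (intro tendsto_mult_right_zero LIMSEQ_power_zero) simp
  have "(\<lambda>k. p (Suc k) x - target T (p k) (2 - 3/4 * (1/2)^k) (b k) x) \<longlonglongrightarrow> 0"
    by (rule Lim_null_comparison[OF _ half[of "1/4"]])
      (use steered in \<open>auto simp: steered_def eventually_sequentially\<close>)
  then have "(\<lambda>j. p (Suc (\<sigma> j)) x - target T (p (\<sigma> j)) (2 - 3/4 * (1/2)^\<sigma> j) (b (\<sigma> j)) x) \<longlonglongrightarrow> 0"
    using \<sigma>_lim by (rule filterlim_compose)
  moreover have "(\<lambda>j. target T (p (\<sigma> j)) (2 - 3/4 * (1/2)^\<sigma> j) (b (\<sigma> j)) x)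
      \<longlonglongrightarrow> t + (2 - 0 - norm t) *\<^sub>R (c - closest_point (T x) c)"
    unfolding target_def \<sigma>(2) \<tau>_def[symmetric]
    by (intro tendsto_intros filterlim_compose[OF t \<sigma>_lim] filterlim_compose[OF half \<sigma>_lim])
  ultimately have "(\<lambda>j. p (Suc (\<sigma> j)) x) \<longlonglongrightarrow> t + (2 - norm t) *\<^sub>R (c - closest_point (T x) c)"
    using tendsto_add by fastforce
  then have pL: "(\<lambda>j. p (Suc (\<sigma> j)) x \<bullet> v) \<longlonglongrightarrow> L"
    unfolding L_def by (intro tendsto_intros)
  \<comment> \<open>Aiming at step \<open>\<sigma> j\<close> shapes the gradient with index
    \<open>Suc (\<sigma> j)\<close>, so this is the scale to look at.\<close>
  define s where "s j = r (Suc (\<sigma> j)) / (norm v + 1)" for j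
  have Suc_lim: "filterlim (\<lambda>j. Suc (\<sigma> j)) sequentially sequentially"
    by (rule filterlim_compose[OF filterlim_Suc \<sigma>_lim])
  have s: "\<And>j. 0 < s j" "s \<longlonglongrightarrow> 0"
    unfolding s_def using slope_along_scales(1)[where v = v]
      filterlim_compose[OF slope_along_scales(2)[where v = v] Suc_lim]
    by auto
  have "(\<lambda>j. (limit_fun (x + s j *\<^sub>R v) - limit_fun x) / s j - p (Suc (\<sigma> j)) x \<bullet> v) \<longlonglongrightarrow> 0"
    unfolding s_def by (rule filterlim_compose[OF slope_along_scales(3)[where v = v] Suc_lim])
  from tendsto_add[OF this pL]
  have "(\<lambda>j. (limit_fun (x + s j *\<^sub>R v) - limit_fun x) / s j) \<longlonglongrightarrow> L"
    by simp
  from Liminf_le_limit_along_sequence[OF s this]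
  show "lower_dir_deriv limit_fun x v \<le> ereal L" "ereal L \<le> upper_dir_deriv limit_fun x v"
    unfolding lower_dir_deriv_def upper_dir_deriv_def by auto
qed

lemma derivative_gap:
  "\<exists>c>0. \<forall>v. ereal (c * infdist v (T x)) \<le> upper_dir_deriv limit_fun x v - lower_dir_deriv limit_fun x v"
proof -
  obtain t where t: "\<tau> \<longlonglongrightarrow> t" "norm t < 2"
    using \<tau>_limit .
  note P = closest_point_subspace[OF subspace_T[of x]]
  let ?P = "closest_point (T x)" and ?A = "2 - norm t"
  have "ereal (?A / DIM('a) * infdist v (T x)) \<le> upper_dir_deriv limit_fun x v - lower_dir_deriv limit_fun x v" for v
  proof -
    let ?w = "v - ?P v"
    define L where "L c = (t + ?A *\<^sub>R (c - ?P c)) \<bullet> v" for c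
    have lower: "lower_dir_deriv limit_fun x v \<le> ereal (L c)"
      and upper: "ereal (L c) \<le> upper_dir_deriv limit_fun x v" if "c \<in> insert 0 Basis" for c
      using derivative_bounds[OF t(1) that, of v] by (auto simp: L_def)
    \<comment> \<open>The absolute values of the coordinates add up to at least the norm, so one of
      them is at least the average.\<close>
    have "\<exists>a\<in>Basis. norm ?w / DIM('a) \<le> \<bar>?w \<bullet> a\<bar>"
    proof (rule ccontr)
      assume "\<not> ?thesis"
      then have "(\<Sum>a\<in>Basis. \<bar>?w \<bullet> a\<bar>) < (\<Sum>a\<in>(Basis::'a set). norm ?w / DIM('a))"
        by (intro sum_strict_mono) auto
      then show False
        using norm_le_l1[of ?w] by simp
    qed
    then obtain a where a: "a \<in> Basis" "norm ?w / DIM('a) \<le> \<bar>?w \<bullet> a\<bar>"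
      by blast
    have P0: "?P 0 = 0"
      by (rule linear_0[OF linear_closest_point_subspace[OF subspace_T]])
    \<comment> \<open>The orthogonal projection is self-adjoint.\<close>
    have "(a - ?P a) \<bullet> v = ?w \<bullet> a"
      using P(2)[OF P(1), of a v] P(2)[OF P(1), of v a]
        inner_commute[of v a] inner_commute[of v "?P a"] inner_commute[of "?P v" "?P a"] inner_commute[of "?P v" a]
      by (simp add: inner_diff_left)
    then have "\<bar>L a - L 0\<bar> = ?A * \<bar>?w \<bullet> a\<bar>"
      using t(2) P0 by (simp add: L_def inner_add_left abs_mult)
    moreover have "?A * (norm ?w / DIM('a)) \<le> ?A * \<bar>?w \<bullet> a\<bar>"
      using t(2) a(2) by (intro mult_left_mono) auto
    ultimately have "?A / DIM('a) * infdist v (T x) \<le> \<bar>L a - L 0\<bar>"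
      by (simp add: infdist_subspace[OF subspace_T])
    \<comment> \<open>The sign of the difference does not matter, because both numbers lie between
      the lower and the upper derivative.\<close>
    also have "\<bar>L a - L 0\<bar> = max (L a) (L 0) - min (L a) (L 0)"
      by simp
    finally have "ereal (?A / DIM('a) * infdist v (T x)) \<le> ereal (max (L a) (L 0)) - ereal (min (L a) (L 0))"
      by (simp only: ereal_minus(1) ereal_less_eq(3))
    also have "\<dots> \<le> upper_dir_deriv limit_fun x v - lower_dir_deriv limit_fun x v"
      using a(1) lower upper by (intro ereal_minus_mono) (auto simp: max_def min_def)
    finally show ?thesis .
  qed
  then show ?thesis
    using t(2) by (intro exI[of _ "?A / DIM('a)"]) auto
qed

end

end

section \<open>Construction of the sequence and conclusion\<close>

lemma exists_steering_sequence:
  fixes \<mu> :: "'a::euclidean_space measure" and T :: "'a \<Rightarrow> 'a set"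
  assumes \<mu>: "radon_measure \<mu>" and T: "T \<in> measurable (completion \<mu>) subspaces_borel"
    and width: "\<And>e \<alpha>. norm e = 1 \<Longrightarrow> 0 < \<alpha> \<Longrightarrow> \<alpha> < 1 \<Longrightarrow>
           \<exists>N E. {x. dir_cone e \<alpha> \<inter> T x = {0}} = N \<union> E \<and>
                 N \<in> null_sets (completion \<mu>) \<and> width e \<alpha> E = 0"
  obtains b f p r K where "steering_sequence T b f p r" "\<And>k. compact (K k)"
    "\<And>k. emeasure \<mu> (cball 0 (real k) - K k) \<le> ennreal ((1/2)^k)"
    "\<And>k x. x \<in> K (Suc k) \<Longrightarrow> steering_sequence.steered T b p k x"
proof -
  have sub: "subspace (T x)" for x
  proof -
    have "T x \<in> space subspaces_borel"
      using measurable_space[OF T, of x] sets_eq_imp_space_eq[OF radon_measure_sets[OF \<mu>]] by simp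
    then show ?thesis
      by (simp add: space_subspaces_borel all_subspaces_imp_subspace)
  qed
  obtain b :: "nat \<Rightarrow> 'a" where b: "range b \<subseteq> insert 0 Basis" "\<And>c. c \<in> insert 0 Basis \<Longrightarrow> infinite {k. b k = c}"
    by (rule exists_recurrent_enumeration[of "insert 0 Basis :: 'a set", OF finite.insertI[OF finite_Basis] insert_not_empty])
      (rule that; assumption)
  have norm_b: "norm (b k) \<le> 1" for k
  proof -
    have "b k \<in> insert 0 Basis"
      using b(1) by blast
    then show ?thesis
      by auto
  qed
  \<comment> \<open>A state consists of a function, its gradient, a scale and the compact set on
    which the last steering succeeded. \<open>good\<close> collects what concerns one state and
    \<open>next_to\<close> what links it to its successor, as dependent choice requires.\<close>
  define good :: "nat \<Rightarrow> ('a \<Rightarrow> real) \<times> ('a \<Rightarrow> 'a) \<times> real \<times> 'a set \<Rightarrow> bool" where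
    "good k = (\<lambda>(f, p, r, K). has_gradient f p \<and> (\<forall>x. norm (p x) \<le> 2 - (1/2)^k) \<and>
       0 < r \<and> r \<le> (1/2)^k \<and>
       (\<forall>x w. norm x \<le> real k \<longrightarrow> norm w \<le> r \<longrightarrow> \<bar>f (x + w) - f x - p x \<bullet> w\<bar> \<le> (1/2)^k * norm w) \<and>
       compact K \<and> emeasure \<mu> (cball 0 (real k) - K) \<le> ennreal ((1/2)^k))" for k
  define next_to :: "nat \<Rightarrow> ('a \<Rightarrow> real) \<times> ('a \<Rightarrow> 'a) \<times> real \<times> 'a set \<Rightarrow> ('a \<Rightarrow> real) \<times> ('a \<Rightarrow> 'a) \<times> real \<times> 'a set \<Rightarrow> bool" where
    "next_to k = (\<lambda>(f, p, r, K) (f', p', r', K'). r' \<le> r \<and> (\<forall>x. \<bar>f' x - f x\<bar> \<le> (1/2)^k * r / 2) \<and>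
       (\<forall>x\<in>K'. norm (p' x - target T p (2 - 3/4 * (1/2)^k) (b k) x) \<le> 1/4 * (1/2)^k))" for k
  \<comment> \<open>The ball of radius 0 is \<open>{0}\<close>, so nothing of it is left outside the
    compact set.\<close>
  have start: "good 0 (\<lambda>x. 0, \<lambda>x. 0, 1, {0})"
    by (simp add: good_def has_gradient_const)
  have step: "\<exists>S'. good (Suc k) S' \<and> next_to k S S'" if S: "good k S" for k S
  proof -
    obtain f p r K where S_eq: "S = (f, p, r, K)"
      by (cases S) auto
    define M where "M = 2 - 3/4 * (1/2::real)^k"
    \<comment> \<open>The first term is the tolerance in \<open>steered\<close>; it also yields the
      next gradient bound and the bound on the missed measure. The second is the change of the
      function allowed at scale \<open>r\<close>.\<close>
    define \<epsilon> where "\<epsilon> = min (1/4 * (1/2)^k) ((1/2)^k * r / 2)"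
    have f: "has_gradient f p" "\<And>x. norm (p x) \<le> 2 - (1/2)^k" "0 < r"
      using S by (auto simp: S_eq good_def)
    have pM: "norm (p x) \<le> M" for x
      using f(2)[of x] by (rule order_trans) (simp add: M_def)
    have \<epsilon>: "0 < \<epsilon>" "\<epsilon> \<le> 1/4 * (1/2)^k" "\<epsilon> \<le> (1/2)^k * r / 2"
      using f(3) by (auto simp: \<epsilon>_def)
    note target = target_props[where T = T and p = p and M = M and b = "b k", OF sub pM norm_b]
    have "p \<in> borel_measurable borel"
      using f(1) by (intro borel_measurable_continuous_onI) (simp add: has_gradient_def)
    then have "p \<in> borel_measurable (completion \<mu>)"
      by (intro measurable_completion) (simp add: measurable_cong_sets[OF radon_measure_sets[OF \<mu>] refl])
    then have meas: "target T p M (b k) \<in> borel_measurable (completion \<mu>)"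
      by (rule target_measurable[OF T sub])
    obtain g q K' where g: "has_gradient g q" "\<And>x. \<bar>g x - f x\<bar> \<le> \<epsilon>" "\<And>x. norm (q x) \<le> M + \<epsilon>"
      "compact K'" "emeasure \<mu> (cball 0 (real (Suc k)) - K') \<le> ennreal \<epsilon>"
      "\<And>x. x \<in> K' \<Longrightarrow> norm (q x - target T p M (b k) x) \<le> \<epsilon>"
      by (rule steer_gradient[OF \<mu> subspace_0[OF sub] width f(1) pM meas target(1,2) \<epsilon>(1), where R = "real (Suc k)"])
        (assumption | rule that; assumption)+
    obtain r' where r': "0 < r'" "r' \<le> (1/2)^Suc k"
      "\<And>x w. norm x \<le> real (Suc k) \<Longrightarrow> norm w \<le> r' \<Longrightarrow> \<bar>g (x + w) - g x - q x \<bullet> w\<bar> \<le> (1/2)^Suc k * norm w"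
      using has_gradient_uniform_on_cball[OF g(1), of "(1/2)^Suc k" "real (Suc k)"] by auto
    have "norm (q x) \<le> 2 - (1/2)^Suc k" for x
      using g(3)[of x] \<epsilon>(2) by (simp add: M_def)
    moreover have "ennreal \<epsilon> \<le> ennreal ((1/2)^Suc k)"
      by (intro ennreal_leI order_trans[OF \<epsilon>(2)]) simp
    ultimately have "good (Suc k) (g, q, min r r', K')"
      using g(1,4,5) r' f(3) unfolding good_def by (auto simp del: power_Suc of_nat_Suc intro: order_trans min.coboundedI2)
    moreover have "next_to k S (g, q, min r r', K')"
      using order_trans[OF g(2) \<epsilon>(3)] order_trans[OF g(6) \<epsilon>(2)]
      unfolding next_to_def S_eq M_def prod.case by (intro conjI min.cobounded1) blast+
    ultimately show ?thesis
      by blast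
  qed
  obtain S where S: "\<And>k. good k (S k)" "\<And>k. next_to k (S k) (S (Suc k))"
    using dependent_nat_choice[of good next_to] start step by metis
  define f p r K where "f k = fst (S k)" and "p k = fst (snd (S k))" and "r k = fst (snd (snd (S k)))"
    and "K k = snd (snd (snd (S k)))" for k
  have S_eq: "S k = (f k, p k, r k, K k)" for k
    by (simp add: f_def p_def r_def K_def)
  note facts = S[unfolded S_eq good_def next_to_def prod.case]
  have seq: "steering_sequence T b f p r"
    by unfold_locales (use sub norm_b b(2) facts in blast)+
  show thesis
  proof (rule that[OF seq])
    show "steering_sequence.steered T b p k x" if "x \<in> K (Suc k)" for k x
      unfolding steering_sequence.steered_def[OF seq] using facts(2)[of k] that by blast
  qed (use facts(1) in blast)+
qed

text \<open>By Borel-Cantelli almost every \<open>x\<close> lies in only finitely many of the missed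
  sets. From some index \<open>k0\<close> on, also chosen at least \<open>norm x\<close>, it
  therefore belongs to every \<open>K (Suc k)\<close>, so steering succeeds at every step from
  \<open>k0\<close> on.\<close>

theorem lipschitz_with_derivative_gap:
  fixes \<mu> :: "'a::euclidean_space measure" and T :: "'a \<Rightarrow> 'a set"
  assumes \<mu>: "radon_measure \<mu>" and T: "T \<in> measurable (completion \<mu>) subspaces_borel"
    and width: "\<And>e \<alpha>. norm e = 1 \<Longrightarrow> 0 < \<alpha> \<Longrightarrow> \<alpha> < 1 \<Longrightarrow>
           \<exists>N E. {x. dir_cone e \<alpha> \<inter> T x = {0}} = N \<union> E \<and>
                 N \<in> null_sets (completion \<mu>) \<and> width e \<alpha> E = 0"
  shows "\<exists>f :: 'a \<Rightarrow> real. (\<exists>L. L-lipschitz_on UNIV f) \<and>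
           (AE x in \<mu>. \<exists>c>0. \<forall>v.
              upper_dir_deriv f x v - lower_dir_deriv f x v \<ge> ereal (c * infdist v (T x)))"
proof -
  obtain b f p r K where seq: "steering_sequence T b f p r" and K: "\<And>k. compact (K k)"
    "\<And>k. emeasure \<mu> (cball 0 (real k) - K k) \<le> ennreal ((1/2)^k)"
    "\<And>k x. x \<in> K (Suc k) \<Longrightarrow> steering_sequence.steered T b p k x"
    by (rule exists_steering_sequence[OF \<mu> T width]) (assumption | rule that; assumption)+
  interpret steering_sequence T b f p r
    by (rule seq)
  have "AE x in \<mu>. \<forall>\<^sub>F k in sequentially. x \<in> space \<mu> - (cball 0 (real k) - K k)"
  proof (rule borel_cantelli_AE1)
    show "cball 0 (real k) - K k \<in> sets \<mu>" for k
      using borel_compact[OF K(1)[of k]] radon_measure_sets[OF \<mu>] by (simp add: sets.Diff)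
    show "emeasure \<mu> (cball 0 (real k) - K k) < \<infinity>" for k
      using K(2)[of k] by (auto intro: le_less_trans)
    have "measure \<mu> (cball 0 (real k) - K k) \<le> (1/2)^k" for k
      using K(2)[of k] by (simp add: measure_def enn2real_leI)
    then show "summable (\<lambda>k. measure \<mu> (cball 0 (real k) - K k))"
      by (intro summable_comparison_test[OF _ summable_geometric[of "1/2::real"]]) auto
  qed
  then have "AE x in \<mu>. \<exists>c>0. \<forall>v.
      ereal (c * infdist v (T x)) \<le> upper_dir_deriv limit_fun x v - lower_dir_deriv limit_fun x v"
  proof eventually_elim
    case (elim x)
    then obtain n where n: "\<And>k. n \<le> k \<Longrightarrow> x \<notin> cball 0 (real k) - K k"
      by (auto simp: eventually_sequentially)
    define k0 where "k0 = max n (nat \<lceil>norm x\<rceil>)"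
    have k0: "norm x \<le> real k0"
      unfolding k0_def by (rule order_trans[OF real_nat_ceiling_ge]) simp
    have "steered k x" if "k0 \<le> k" for k
    proof (rule K(3))
      show "x \<in> K (Suc k)"
        using n[of "Suc k"] that k0 by (auto simp: k0_def)
    qed
    then show ?case
      using derivative_gap k0 by blast
  qed
  then show ?thesis
    using lipschitz_limit_fun by blast
qed

theorem corollary1p12:
  fixes \<mu> :: "(real ^ 'n) measure" and T :: "real ^ 'n \<Rightarrow> (real ^ 'n) set"
  assumes "radon_measure \<mu>"
    and "T \<in> measurable (completion \<mu>) subspaces_borel"
    and "\<And>e \<alpha>. norm e = 1 \<Longrightarrow> 0 < \<alpha> \<Longrightarrow> \<alpha> < 1 \<Longrightarrow>
           \<exists>N E. {x. dir_cone e \<alpha> \<inter> T x = {0}} = N \<union> E \<and>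
                 N \<in> null_sets (completion \<mu>) \<and> width e \<alpha> E = 0"
  shows "\<exists>f :: real ^ 'n \<Rightarrow> real. (\<exists>L. L-lipschitz_on UNIV f) \<and>
           (AE x in \<mu>. \<exists>c>0. \<forall>v.
              upper_dir_deriv f x v - lower_dir_deriv f x v \<ge> ereal (c * infdist v (T x)))"
  by (rule lipschitz_with_derivative_gap[OF assms(1,2)]) (rule assms(3))

end
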